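(* Let $Q$ be a symmetric positive semidefinite $n\times n$ real matrix, let $a_1,\dots,a_m\in\mathbb{R}^n$, and let $\mathcal{S}(c,b)=\arg\min\{\tfrac12 x'Qx+c'x : a_i'x\le b_i,\ i=1,\dots,m\}$ for $(c,b)\in\mathbb{R}^n\times\mathbb{R}^m$. Let $(\overline c,\overline b)\in\mathbb{R}^n\times\mathbb{R}^m$ be such that the Slater constraint qualification holds at $\overline b$ and assume $\mathcal{S}(\overline c,\overline b)=\{\overline x\}$. The following conditions are equivalent: (i) $\mathcal{S}$ has the Aubin property at $((\overline c,\overline b),\overline x)$; (ii) $M_D$ is nonsingular for all $D\in\mathcal{M}_{\overline c,\overline b}(\overline x)$; (iii) $M_D$ is nonsingular for all $D\in\mathcal{L}_{\overline c,\overline b}(\overline x)$. Moreover, under these equivalent conditions, $$\mathrm{lip}\,\mathcal{S}((\overline c,\overline b),\overline x)=\max_{D\in\mathcal{L}_{\overline c,\overline b}(\overline x)}\left\Vert \begin{pmatrix} I_n & 0_{n\times|D|}\end{pmatrix}M_D^{-1}\right\Vert .$$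
   Context: Vectors are columns and the prime denotes transposition. $\mathbb{R}^n$ (the space of the variable $x$) carries an arbitrary norm $\|\cdot\|$ with dual norm $\|u\|_*=\max_{\|y\|\le1}|u'y|$; the parameter space $\mathbb{R}^n\times\mathbb{R}^m$ carries the norm $\|(c,b)\|=\max\{\|c\|_*,\|b\|_\infty\}$. Distances $d$ are induced by these norms, and $d(x,\emptyset)=+\infty$. $I=\{1,\dots,m\}$; $\mathcal{F}(b)=\{x: a_i'x\le b_i,\ i\in I\}$. For $x\in\mathcal{F}(b)$, $I_b(x)=\{i\in I: a_i'x=b_i\}$. The Slater constraint qualification (SCQ) holds at $b$ if there is $y\in\mathbb{R}^n$ with $a_i'y<b_i$ for all $i\in I$. $\mathrm{cone}\,X$ is the convex conical hull of $X$, containing the origin, with $\mathrm{cone}\,\emptyset=\{0_n\}$. Aubin property: $\mathcal{S}$ has the Aubin property at $((\overline c,\overline b),\overline x)\in\mathrm{gph}\,\mathcal{S}$ if there are neighborhoods $U$ of $\overline x$ and $V$ of $(\overline c,\overline b)$ and $\kappa\ge0$ such that $d(x^2,\mathcal{S}(c^1,b^1))\le\kappa\, d((c^2,b^2),(c^1,b^1))$ whenever $(c^1,b^1),(c^2,b^2)\in V$ and $x^2\in\mathcal{S}(c^2,b^2)\cap U$. The Lipschitz modulus $\mathrm{lip}\,\mathcal{S}((\overline c,\overline b),\overline x)$ is the infimum of all such $\kappa$ (over all choices of neighborhoods), and is $+\infty$ if the Aubin property fails. For $((c,b),x)\in\mathrm{gph}\,\mathcal{S}$: $\mathcal{M}_{c,b}(x)$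 is the family of all $D\subset I_b(x)$ such that $-(Qx+c)\in\mathrm{cone}\{a_i,i\in D\}$ and no proper subset of $D$ has this property; $\mathcal{L}_{c,b}(x)$ is the family of all $D\subset I_b(x)$ such that $\{a_i,i\in D\}$ is linearly independent (as an indexed family) and $-(Qx+c)\in\mathrm{cone}\{a_i,i\in D\}$. The set $D=\emptyset$ is allowed. For $D\subset I$, $A_D$ is the matrix with rows $a_i'$, $i\in D$, and $M_D=\begin{pmatrix}Q & A_D'\\ A_D & 0_{D\times D}\end{pmatrix}$, with $M_\emptyset=Q$. The matrix norm is $$\left\Vert \begin{pmatrix} I_n & 0_{n\times|D|}\end{pmatrix}M_D^{-1}\right\Vert=\max_{\max\{\|\alpha\|_*,\|\beta\|_\infty\}=1}\left\Vert \begin{pmatrix} I_n & 0_{n\times|D|}\end{pmatrix}M_D^{-1}\binom{\alpha}{\beta}\right\Vert,$$ with $\alpha\in\mathbb{R}^n,\beta\in\mathbb{R}^D$ (no $\beta$ when $D=\emptyset$). *)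

theory Defs
  imports "HOL-Analysis.Analysis"
begin

text \<open>
  The type class norm on \<^typ>\<open>real^'n\<close> is the Euclidean one, so an arbitrary norm is a
  function \<open>N\<close> satisfying the norm axioms. As all norms on a finite-dimensional space are
  equivalent, neighbourhoods may be taken in the standard topology of the type.
\<close>

definition is_norm :: "(real^'n \<Rightarrow> real) \<Rightarrow> bool" where
  "is_norm N \<longleftrightarrow>
     (\<forall>x. 0 \<le> N x) \<and> (\<forall>x. N x = 0 \<longleftrightarrow> x = 0) \<and>
     (\<forall>r x. N (r *\<^sub>R x) = \<bar>r\<bar> * N x) \<and> (\<forall>x y. N (x + y) \<le> N x + N y)"

text \<open>For a norm \<open>N\<close> the set below is nonempty and compact, so the supremum is a maximum.\<close>

definition dual_norm :: "(real^'n \<Rightarrow> real) \<Rightarrow> real^'n \<Rightarrow> real" where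
  "dual_norm N u = Sup {\<bar>u \<bullet> y\<bar> | y. N y \<le> 1}"

definition param_norm :: "(real^'n \<Rightarrow> real) \<Rightarrow> (real^'n) \<times> (real^'m) \<Rightarrow> real" where
  "param_norm N p = max (dual_norm N (fst p)) (infnorm (snd p))"

text \<open>The infimum is taken in \<^typ>\<open>ereal\<close>, where the infimum of the empty set is \<open>\<infinity>\<close>.\<close>

definition dist_to_set :: "(real^'n \<Rightarrow> real) \<Rightarrow> real^'n \<Rightarrow> (real^'n) set \<Rightarrow> ereal" where
  "dist_to_set N x A = (INF y\<in>A. ereal (N (x - y)))"

definition aubin_constant ::
    "(real^'n \<Rightarrow> real) \<Rightarrow> ((real^'n) \<times> (real^'m) \<Rightarrow> (real^'n) set) \<Rightarrow>
     (real^'n) \<times> (real^'m) \<Rightarrow> real^'n \<Rightarrow> real \<Rightarrow> bool" where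
  "aubin_constant N S p x \<kappa> \<longleftrightarrow>
     0 \<le> \<kappa> \<and>
     (\<exists>U V. open U \<and> x \<in> U \<and> open V \<and> p \<in> V \<and>
        (\<forall>p1\<in>V. \<forall>p2\<in>V. \<forall>x2\<in>S p2 \<inter> U.
           dist_to_set N x2 (S p1) \<le> ereal (\<kappa> * param_norm N (p2 - p1))))"

definition aubin_property ::
    "(real^'n \<Rightarrow> real) \<Rightarrow> ((real^'n) \<times> (real^'m) \<Rightarrow> (real^'n) set) \<Rightarrow>
     (real^'n) \<times> (real^'m) \<Rightarrow> real^'n \<Rightarrow> bool" where
  "aubin_property N S p x \<longleftrightarrow> x \<in> S p \<and> (\<exists>\<kappa>. aubin_constant N S p x \<kappa>)"

definition lip_modulus ::
    "(real^'n \<Rightarrow> real) \<Rightarrow> ((real^'n) \<times> (real^'m) \<Rightarrow> (real^'n) set) \<Rightarrow>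
     (real^'n) \<times> (real^'m) \<Rightarrow> real^'n \<Rightarrow> ereal" where
  "lip_modulus N S p x = (INF \<kappa>\<in>{\<kappa>. aubin_constant N S p x \<kappa>}. ereal \<kappa>)"

definition pos_semidef :: "real^'n^'n \<Rightarrow> bool" where
  "pos_semidef Q \<longleftrightarrow> (\<forall>x. 0 \<le> x \<bullet> (Q *v x))"

definition feasible :: "('m \<Rightarrow> real^'n) \<Rightarrow> real^'m \<Rightarrow> (real^'n) set" where
  "feasible a b = {x. \<forall>i. a i \<bullet> x \<le> b $ i}"

definition qp_objective :: "real^'n^'n \<Rightarrow> real^'n \<Rightarrow> real^'n \<Rightarrow> real" where
  "qp_objective Q c x = 1/2 * (x \<bullet> (Q *v x)) + c \<bullet> x"

definition qp_argmin ::
    "real^'n^'n \<Rightarrow> ('m \<Rightarrow> real^'n) \<Rightarrow> (real^'n) \<times> (real^'m) \<Rightarrow> (real^'n) set" where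
  "qp_argmin Q a = (\<lambda>(c, b). {x. is_arg_min (qp_objective Q c) (\<lambda>y. y \<in> feasible a b) x})"

definition slater :: "('m \<Rightarrow> real^'n) \<Rightarrow> real^'m \<Rightarrow> bool" where
  "slater a b \<longleftrightarrow> (\<exists>y. \<forall>i. a i \<bullet> y < b $ i)"

definition active :: "('m \<Rightarrow> real^'n) \<Rightarrow> real^'m \<Rightarrow> real^'n \<Rightarrow> 'm set" where
  "active a b x = {i. a i \<bullet> x = b $ i}"

text \<open>A \<^const>\<open>convex_cone\<close> is nonempty, hence contains the origin, and
  \<open>convex_cone hull {} = {0}\<close>.\<close>

definition kkt_set ::
    "real^'n^'n \<Rightarrow> ('m \<Rightarrow> real^'n) \<Rightarrow> real^'n \<Rightarrow> real^'n \<Rightarrow> 'm set \<Rightarrow> bool" where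
  "kkt_set Q a c x D \<longleftrightarrow> - (Q *v x + c) \<in> convex_cone hull (a ` D)"

definition minimal_kkt_sets ::
    "real^'n^'n \<Rightarrow> ('m \<Rightarrow> real^'n) \<Rightarrow> real^'n \<Rightarrow> real^'m \<Rightarrow> real^'n \<Rightarrow> 'm set set" where
  "minimal_kkt_sets Q a c b x =
     {D. D \<subseteq> active a b x \<and> kkt_set Q a c x D \<and> (\<forall>D'. D' \<subset> D \<longrightarrow> \<not> kkt_set Q a c x D')}"

text \<open>Injectivity makes this linear independence of the indexed family rather than of its range.\<close>

definition independent_kkt_sets ::
    "real^'n^'n \<Rightarrow> ('m \<Rightarrow> real^'n) \<Rightarrow> real^'n \<Rightarrow> real^'m \<Rightarrow> real^'n \<Rightarrow> 'm set set" where
  "independent_kkt_sets Q a c b x =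
     {D. D \<subseteq> active a b x \<and> inj_on a D \<and> independent (a ` D) \<and> kkt_set Q a c x D}"

text \<open>
  The size of the matrix \<open>M\<^sub>D\<close> varies with \<open>D\<close>, so a square matrix is a function of two indices
  together with the finite set \<open>J\<close> that the indices range over; values at indices outside \<open>J\<close> are
  irrelevant. The matrix \<open>M\<^sub>D\<close> is \<open>kkt_matrix Q a\<close> on the index set \<open>UNIV <+> D\<close>: the \<open>Inl\<close>
  indices are the coordinates of \<open>\<real>\<^sup>n\<close> and the \<open>Inr\<close> indices the elements of \<open>D\<close>.
\<close>

definition is_inverse_on :: "'k set \<Rightarrow> ('k \<Rightarrow> 'k \<Rightarrow> real) \<Rightarrow> ('k \<Rightarrow> 'k \<Rightarrow> real) \<Rightarrow> bool" where
  "is_inverse_on J M W \<longleftrightarrow>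
     (\<forall>i\<in>J. \<forall>j\<in>J. (\<Sum>k\<in>J. M i k * W k j) = (if i = j then 1 else 0) \<and>
                  (\<Sum>k\<in>J. W i k * M k j) = (if i = j then 1 else 0))"

definition nonsingular_on :: "'k set \<Rightarrow> ('k \<Rightarrow> 'k \<Rightarrow> real) \<Rightarrow> bool" where
  "nonsingular_on J M \<longleftrightarrow> (\<exists>W. is_inverse_on J M W)"

text \<open>The entries with both indices in \<open>J\<close> are uniquely determined if \<open>M\<close> is nonsingular.\<close>

definition inverse_on :: "'k set \<Rightarrow> ('k \<Rightarrow> 'k \<Rightarrow> real) \<Rightarrow> 'k \<Rightarrow> 'k \<Rightarrow> real" where
  "inverse_on J M = (SOME W. is_inverse_on J M W)"

fun kkt_matrix ::
    "real^'n^'n \<Rightarrow> ('m \<Rightarrow> real^'n) \<Rightarrow> 'n + 'm \<Rightarrow> 'n + 'm \<Rightarrow> real" where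
  "kkt_matrix Q a (Inl j) (Inl l) = Q $ j $ l"
| "kkt_matrix Q a (Inl j) (Inr i) = a i $ j"
| "kkt_matrix Q a (Inr i) (Inl j) = a i $ j"
| "kkt_matrix Q a (Inr i) (Inr k) = 0"

text \<open>The first \<open>n\<close> components of the product of the inverse of \<open>M\<^sub>D\<close> with the stacked vector of
  \<open>\<alpha>\<close> and \<open>\<beta>\<close>, of which only the components of \<open>\<beta>\<close> in \<open>D\<close> are used.\<close>

definition kkt_inverse_top ::
    "real^'n^'n \<Rightarrow> ('m \<Rightarrow> real^'n) \<Rightarrow> 'm set \<Rightarrow> real^'n \<Rightarrow> real^'m \<Rightarrow> real^'n" where
  "kkt_inverse_top Q a D \<alpha> \<beta> =
     (\<chi> j. \<Sum>k\<in>UNIV <+> D. inverse_on (UNIV <+> D) (kkt_matrix Q a) (Inl j) k *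
             (case k of Inl l \<Rightarrow> \<alpha> $ l | Inr i \<Rightarrow> \<beta> $ i))"

text \<open>
  A vector \<open>\<beta>\<close> with index set \<open>D\<close> is a vector in \<^typ>\<open>real^'m\<close> vanishing off \<open>D\<close>, which does not
  change its maximum norm. The unit sphere is compact and nonempty, so the supremum is a maximum.
\<close>

definition kkt_inverse_norm ::
    "(real^'n \<Rightarrow> real) \<Rightarrow> real^'n^'n \<Rightarrow> ('m::finite \<Rightarrow> real^'n) \<Rightarrow> 'm set \<Rightarrow> real" where
  "kkt_inverse_norm N Q a D =
     Sup {N (kkt_inverse_top Q a D \<alpha> \<beta>) | \<alpha> \<beta>.
            (\<forall>i. i \<notin> D \<longrightarrow> \<beta> $ i = 0) \<and> max (dual_norm N \<alpha>) (infnorm \<beta>) = 1}"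

end

(* The KKT conditions express a solution x(c, b) as the first block of the inverse of M_D applied to
   (-c, b_D), for some D in the family L of the perturbed problem.  By closedness of finitely generated
   cones, near the reference point only sets D in the reference family occur, so the solution map is
   single-valued and piecewise linear along segments, with finitely many closed pieces; this bounds
   its Lipschitz modulus by the largest piece.  Conversely, subtracting multiples of the a_i, i in D,
   from c and relaxing the constraints outside D makes any given D in L strictly complementary and
   its constraints the only active ones, so every piece is attained near the reference point; if M_D
   is singular, the same relaxation yields a segment of solutions, which a tilt of c destroys. *)

theory Submission
  imports Defs
begin

section \<open>Finitely generated cones and matrices on finite index sets\<close>

text \<open>Minimal KKT sets cannot carry the limit argument: a multiplier that is positive at
  nearby parameters may vanish at the reference point, so a nearby minimal set need not be minimal
  there. What survives is linear independence, which involves no parameter, and the KKT relation for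
  fixed D, which is closed; this is why the modulus is a maximum over the family L. For (ii) and
  (iii) the two families are interchangeable: every member of L contains a minimal set, and for
  independent D positive semidefiniteness of Q reduces nonsingularity of M_D to the absence of a
  nonzero x with Qx = 0 that is orthogonal to a_i for all i in D, a condition inherited by larger D.
  Slater's condition and the uniqueness of the solution keep nearby solution sets nonempty and close
  to xbar: a strictly feasible point stays feasible, and convexity turns its advantage over a small
  sphere into an advantage over everything outside that sphere. The estimate is sharp without an
  epsilon because the Lipschitz constants of the pieces met along a segment do not accumulate, so
  the maximum is itself an admissible constant.\<close>

lemma convex_cone_hull_image_iff:
  fixes a :: "'i \<Rightarrow> 'a::real_vector"
  assumes "finite D"
  shows "v \<in> convex_cone hull (a ` D) \<longleftrightarrow>
    (\<exists>l. (\<forall>i\<in>D. 0 \<le> l i) \<and> v = (\<Sum>i\<in>D. l i *\<^sub>R a i))"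
proof
  let ?C = "{v. \<exists>l. (\<forall>i\<in>D. 0 \<le> l i) \<and> v = (\<Sum>i\<in>D. l i *\<^sub>R a i)}"
  have "convex_cone ?C"
    unfolding convex_cone_iff
  proof (intro conjI ballI allI impI)
    show "0 \<in> ?C"
      by (intro CollectI exI[of _ "\<lambda>_. 0"]) simp
    fix x assume "x \<in> ?C"
    then obtain l where l: "\<forall>i\<in>D. 0 \<le> l i" "x = (\<Sum>i\<in>D. l i *\<^sub>R a i)" by blast
    show "r *\<^sub>R x \<in> ?C" if "0 \<le> r" for r
      using l that by (intro CollectI exI[of _ "\<lambda>i. r * l i"]) (simp add: scaleR_sum_right)
    fix y assume "y \<in> ?C"
    then obtain m where m: "\<forall>i\<in>D. 0 \<le> m i" "y = (\<Sum>i\<in>D. m i *\<^sub>R a i)" by blast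
    show "x + y \<in> ?C"
      using l m by (intro CollectI exI[of _ "\<lambda>i. l i + m i"]) (simp add: scaleR_add_left sum.distrib)
  qed
  moreover have "a ` D \<subseteq> ?C"
  proof clarify
    fix i assume "i \<in> D"
    then have "(\<Sum>k\<in>D. (if k = i then 1 else 0) *\<^sub>R a k) = a i"
      using assms by (simp add: if_distrib[of "\<lambda>r. r *\<^sub>R _"] sum.delta cong: if_cong)
    then show "\<exists>l. (\<forall>i\<in>D. 0 \<le> l i) \<and> a i = (\<Sum>i\<in>D. l i *\<^sub>R a i)"
      by (intro exI[of _ "\<lambda>k. if k = i then 1 else 0"]) auto
  qed
  ultimately have "convex_cone hull (a ` D) \<subseteq> ?C"
    by (simp add: hull_minimal)
  then show "\<exists>l. (\<forall>i\<in>D. 0 \<le> l i) \<and> v = (\<Sum>i\<in>D. l i *\<^sub>R a i)"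
    if "v \<in> convex_cone hull (a ` D)"
    using that by blast
next
  assume "\<exists>l. (\<forall>i\<in>D. 0 \<le> l i) \<and> v = (\<Sum>i\<in>D. l i *\<^sub>R a i)"
  then obtain l where l: "\<forall>i\<in>D. 0 \<le> l i" and v: "v = (\<Sum>i\<in>D. l i *\<^sub>R a i)" by blast
  have "(\<Sum>i\<in>E. l i *\<^sub>R a i) \<in> convex_cone hull (a ` D)" if "E \<subseteq> D" for E
  proof -
    have "finite E" using that assms finite_subset by blast
    then show ?thesis
      using that
    proof (induction E)
      case empty
      then show ?case by (simp add: convex_cone_hull_contains_0)
    next
      case (insert i E)
      then have "l i *\<^sub>R a i \<in> convex_cone hull (a ` D)"
        using l by (intro convex_cone_hull_mul hull_inc) auto
      then show ?case
        using insert by (simp add: convex_cone_hull_add)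
    qed
  qed
  then show "v \<in> convex_cone hull (a ` D)"
    using v by blast
qed

text \<open>Coefficients are attached to indices, not to vectors, so repeated vectors count as
  dependent and KKT multipliers can be inserted directly.\<close>

definition independent_family :: "('i \<Rightarrow> 'a::real_vector) \<Rightarrow> 'i set \<Rightarrow> bool" where
  "independent_family a D \<longleftrightarrow>
     (\<forall>m. (\<Sum>i\<in>D. m i *\<^sub>R a i) = 0 \<longrightarrow> (\<forall>i\<in>D. m i = 0))"

lemma independent_family_iff:
  fixes a :: "'i \<Rightarrow> 'a::real_vector"
  assumes "finite D"
  shows "independent_family a D \<longleftrightarrow> inj_on a D \<and> independent (a ` D)"
proof (intro iffI conjI)
  assume indep: "independent_family a D"
  show inj: "inj_on a D"
  proof (rule inj_onI, rule ccontr)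
    fix i k assume ik: "i \<in> D" "k \<in> D" "a i = a k" "i \<noteq> k"
    \<comment> \<open>A repeated vector gives the nontrivial relation with coefficient 1 at
      \<open>i\<close> and -1 at \<open>k\<close>.\<close>
    define m where "m j = (if j = i then 1 else 0) - (if j = k then 1 else (0::real))" for j
    have "(\<Sum>j\<in>D. m j *\<^sub>R a j) = a i - a k"
      using assms ik unfolding m_def scaleR_left_diff_distrib sum_subtractf
      by (simp add: if_distrib[of "\<lambda>r. r *\<^sub>R _"] sum.delta cong: if_cong)
    then have "m i = 0"
      using ik indep unfolding independent_family_def by auto
    then show False
      using ik by (simp add: m_def)
  qed
  show "independent (a ` D)"
  proof (rule independent_if_scalars_zero)
    show "finite (a ` D)" using assms by simp
    fix f x assume f: "(\<Sum>x\<in>a ` D. f x *\<^sub>R x) = 0" and x: "x \<in> a ` D"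
    have "(\<Sum>i\<in>D. f (a i) *\<^sub>R a i) = 0"
      using f by (simp add: sum.reindex[OF inj])
    then have "\<forall>i\<in>D. f (a i) = 0"
      using indep unfolding independent_family_def by (elim allE[of _ "\<lambda>i. f (a i)"]) simp
    then show "f x = 0" using x by auto
  qed
next
  assume R: "inj_on a D \<and> independent (a ` D)"
  show "independent_family a D"
    unfolding independent_family_def
  proof (intro allI impI ballI)
    fix m i assume m: "(\<Sum>i\<in>D. m i *\<^sub>R a i) = 0" and i: "i \<in> D"
    have "(\<Sum>x\<in>a ` D. m (inv_into D a x) *\<^sub>R x) = 0"
      using R m by (simp add: sum.reindex inv_into_f_f)
    then have "m (inv_into D a (a i)) = 0"
      using R i assms independentD[of "a ` D" "a ` D" "\<lambda>x. m (inv_into D a x)" "a i"] by auto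
    then show "m i = 0" using R i by (simp add: inv_into_f_f)
  qed
qed

text \<open>Caratheodory's reduction: along a linear relation with a positive coefficient, a
  nonnegative representation of \<open>v\<close> can be shifted until one coefficient vanishes while
  the others stay nonnegative, which contradicts minimality. Applied to a relation and to its
  negative, this rules out all nontrivial relations.\<close>

lemma minimal_cone_coeffs:
  fixes a :: "'i \<Rightarrow> 'a::real_vector"
  assumes "finite D"
    and "v \<in> convex_cone hull (a ` D)"
    and min: "\<And>D'. D' \<subset> D \<Longrightarrow> v \<notin> convex_cone hull (a ` D')"
  obtains l where "v = (\<Sum>i\<in>D. l i *\<^sub>R a i)" "\<And>i. i \<in> D \<Longrightarrow> 0 < l i" "independent_family a D"
proof -
  \<comment> \<open>Stated for every nonnegative representation because it is applied again to the
    shifted coefficients.\<close>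
  have nonzero: "l i \<noteq> 0"
    if "v = (\<Sum>i\<in>D. l i *\<^sub>R a i)" "\<forall>i\<in>D. 0 \<le> l i" "i \<in> D" for l i
  proof
    assume "l i = 0"
    then have "v = (\<Sum>i\<in>D - {i}. l i *\<^sub>R a i)"
      using that assms(1) by (simp add: sum.remove)
    moreover have "\<forall>i\<in>D - {i}. 0 \<le> l i"
      using that by simp
    ultimately have "v \<in> convex_cone hull (a ` (D - {i}))"
      using assms(1) by (subst convex_cone_hull_image_iff) auto
    then show False
      using min[of "D - {i}"] that by blast
  qed
  obtain l where l: "\<forall>i\<in>D. 0 \<le> l i" "v = (\<Sum>i\<in>D. l i *\<^sub>R a i)"
    using assms(1,2) by (auto simp: convex_cone_hull_image_iff)
  have pos: "0 < l i" if "i \<in> D" for i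
    using nonzero[OF l(2,1) that] l(1) that by fastforce
  have no_pos: "m j \<le> 0" if m: "(\<Sum>i\<in>D. m i *\<^sub>R a i) = 0" and j: "j \<in> D" for m j
  proof (rule ccontr)
    assume "\<not> m j \<le> 0"
    define P where "P = {i\<in>D. 0 < m i}"
    have P: "finite P" "P \<noteq> {}"
      using assms(1) j \<open>\<not> m j \<le> 0\<close> by (auto simp: P_def)
    \<comment> \<open>The ratio test: the largest shift that keeps all coefficients nonnegative; it
      brings the one at \<open>k\<close> to zero.\<close>
    define t where "t = Min ((\<lambda>i. l i / m i) ` P)"
    obtain k where k: "k \<in> P" "t = l k / m k"
      using Min_in[of "(\<lambda>i. l i / m i) ` P"] P unfolding t_def by (auto simp del: Min_in)
    have t0: "0 \<le> t"
      using k l(1) by (simp add: P_def)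
    have "0 \<le> l i - t * m i" if "i \<in> D" for i
    proof (cases "0 < m i")
      case True
      then have "t \<le> l i / m i"
        using P that unfolding t_def by (intro Min_le) (auto simp: P_def)
      then show ?thesis using True by (simp add: field_simps)
    next
      case False
      then have "t * m i \<le> 0" using t0 by (simp add: mult_nonneg_nonpos)
      then show ?thesis using l(1) that by fastforce
    qed
    moreover have "v = (\<Sum>i\<in>D. (l i - t * m i) *\<^sub>R a i)"
    proof -
      have "(\<Sum>i\<in>D. (l i - t * m i) *\<^sub>R a i) = v - t *\<^sub>R (\<Sum>i\<in>D. m i *\<^sub>R a i)"
        using l(2) by (simp add: scaleR_left_diff_distrib sum_subtractf scaleR_sum_right)
      then show ?thesis using m by simp
    qed
    ultimately have "l k - t * m k \<noteq> 0"
      using nonzero[of "\<lambda>i. l i - t * m i" k] k by (auto simp: P_def)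
    then show False using k by (simp add: P_def)
  qed
  have "independent_family a D"
    unfolding independent_family_def
  proof (intro allI impI ballI)
    fix m i assume m: "(\<Sum>i\<in>D. m i *\<^sub>R a i) = 0" and i: "i \<in> D"
    have "(\<Sum>i\<in>D. (- m i) *\<^sub>R a i) = 0"
      using m by (simp add: sum_negf)
    then show "m i = 0"
      using no_pos[OF m i] no_pos[of "\<lambda>i. - m i" i] i by force
  qed
  then show thesis using that l pos by blast
qed

lemma finite_minimal_subset:
  assumes "finite D" "P D"
  obtains D0 where "D0 \<subseteq> D" "P D0" "\<And>D'. D' \<subset> D0 \<Longrightarrow> \<not> P D'"
proof -
  have "\<exists>D0\<subseteq>D. P D0 \<and> (\<forall>D'. D' \<subset> D0 \<longrightarrow> \<not> P D')"
    using assms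
  proof (induction D rule: finite_psubset_induct)
    case (psubset A)
    show ?case
    proof (cases "\<exists>B\<subset>A. P B")
      case True
      then obtain B where "B \<subset> A" "P B" by blast
      then show ?thesis using psubset.IH[of B] by (meson psubset_imp_subset subset_trans)
    next
      case False
      then show ?thesis using psubset.prems by blast
    qed
  qed
  then show thesis using that by blast
qed

section \<open>Square matrices over a subset of the index type\<close>

text \<open>Filling up \<open>M\<close> with the identity outside \<open>J\<close> gives a matrix
  over the whole index type whose kernel vectors vanish off \<open>J\<close>. For such a matrix a
  trivial kernel yields a left inverse, which is also a right inverse; its restriction to
  \<open>J\<close> inverts \<open>M\<close>.\<close>

lemma nonsingular_on_iff_kernel:
  fixes J :: "'k::finite set"
  shows "nonsingular_on J M \<longleftrightarrow>
    (\<forall>v. (\<forall>i\<in>J. (\<Sum>k\<in>J. M i k * v k) = 0) \<longrightarrow> (\<forall>k\<in>J. v k = 0))"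
proof
  assume "nonsingular_on J M"
  then obtain W where W: "is_inverse_on J M W"
    unfolding nonsingular_on_def by blast
  show "\<forall>v. (\<forall>i\<in>J. (\<Sum>k\<in>J. M i k * v k) = 0) \<longrightarrow> (\<forall>k\<in>J. v k = 0)"
  proof (intro allI impI ballI)
    fix v j assume v: "\<forall>i\<in>J. (\<Sum>k\<in>J. M i k * v k) = 0" and j: "j \<in> J"
    have "v j = (\<Sum>i\<in>J. (if j = i then 1 else 0) * v i)"
      using j by (simp add: if_distrib[of "\<lambda>r. r * _"] sum.delta cong: if_cong)
    also have "\<dots> = (\<Sum>i\<in>J. (\<Sum>k\<in>J. W j k * M k i) * v i)"
      using W j unfolding is_inverse_on_def by (intro sum.cong) auto
    also have "\<dots> = (\<Sum>i\<in>J. \<Sum>k\<in>J. W j k * (M k i * v i))"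
      by (simp add: sum_distrib_right mult.assoc)
    also have "\<dots> = (\<Sum>k\<in>J. W j k * (\<Sum>i\<in>J. M k i * v i))"
      by (subst sum.swap) (simp add: sum_distrib_left)
    also have "\<dots> = 0" using v by simp
    finally show "v j = 0" .
  qed
next
  assume ker: "\<forall>v. (\<forall>i\<in>J. (\<Sum>k\<in>J. M i k * v k) = 0) \<longrightarrow> (\<forall>k\<in>J. v k = 0)"
  define A :: "real^'k^'k" where
    "A = (\<chi> i j. if i \<in> J \<and> j \<in> J then M i j else if i = j then 1 else 0)"
  have row: "(\<Sum>k\<in>UNIV. A $ i $ k * f k) = (\<Sum>k\<in>J. M i k * f k)" if "i \<in> J" for i f
  proof -
    have "(\<Sum>k\<in>UNIV. A $ i $ k * f k) = (\<Sum>k\<in>J. A $ i $ k * f k)"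
      using that by (intro sum.mono_neutral_right) (auto simp: A_def)
    then show ?thesis using that by (simp add: A_def)
  qed
  have col: "(\<Sum>k\<in>UNIV. f k * A $ k $ j) = (\<Sum>k\<in>J. f k * M k j)" if "j \<in> J" for j f
  proof -
    have "(\<Sum>k\<in>UNIV. f k * A $ k $ j) = (\<Sum>k\<in>J. f k * A $ k $ j)"
      using that by (intro sum.mono_neutral_right) (auto simp: A_def)
    then show ?thesis using that by (simp add: A_def)
  qed
  have "\<forall>x. A *v x = 0 \<longrightarrow> x = 0"
  proof (intro allI impI)
    fix x assume x: "A *v x = 0"
    have Ax: "(\<Sum>k\<in>UNIV. A $ i $ k * x $ k) = 0" for i
      using x by (simp add: vec_eq_iff matrix_vector_mult_def)
    have "x $ i = 0" if "i \<notin> J" for i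
    proof -
      have "(\<Sum>k\<in>UNIV. A $ i $ k * x $ k) = (\<Sum>k\<in>UNIV. if i = k then x $ k else 0)"
        using that by (intro sum.cong) (auto simp: A_def)
      then show ?thesis using Ax[of i] by simp
    qed
    moreover have "x $ i = 0" if "i \<in> J" for i
    proof -
      have "\<forall>i\<in>J. (\<Sum>k\<in>J. M i k * x $ k) = 0"
        using Ax row[of _ "\<lambda>k. x $ k"] by simp
      then show ?thesis using ker that by blast
    qed
    ultimately show "x = 0" by (auto simp: vec_eq_iff)
  qed
  then obtain B where B: "B ** A = mat 1"
    using matrix_left_invertible_ker by blast
  then have B': "A ** B = mat 1"
    by (simp add: matrix_left_right_inverse)
  have "is_inverse_on J M (\<lambda>i j. B $ i $ j)"
    unfolding is_inverse_on_def
  proof (intro ballI conjI)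
    fix i j assume ij: "i \<in> J" "j \<in> J"
    show "(\<Sum>k\<in>J. M i k * B $ k $ j) = (if i = j then 1 else 0)"
      using arg_cong[OF B', of "\<lambda>X. X $ i $ j"] row[OF ij(1), of "\<lambda>k. B $ k $ j"]
      by (simp add: matrix_matrix_mult_def mat_def)
    show "(\<Sum>k\<in>J. B $ i $ k * M k j) = (if i = j then 1 else 0)"
      using arg_cong[OF B, of "\<lambda>X. X $ i $ j"] col[OF ij(2), of "\<lambda>k. B $ i $ k"]
      by (simp add: matrix_matrix_mult_def mat_def)
  qed
  then show "nonsingular_on J M"
    unfolding nonsingular_on_def by blast
qed

lemma inverse_on_solves:
  assumes "nonsingular_on J M" "finite J" "i \<in> J"
  shows "(\<Sum>j\<in>J. M i j * (\<Sum>k\<in>J. inverse_on J M j k * y k)) = y i"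
proof -
  have W: "is_inverse_on J M (inverse_on J M)"
    using assms(1) unfolding nonsingular_on_def inverse_on_def by (rule someI_ex)
  have "(\<Sum>j\<in>J. M i j * (\<Sum>k\<in>J. inverse_on J M j k * y k))
      = (\<Sum>j\<in>J. \<Sum>k\<in>J. (M i j * inverse_on J M j k) * y k)"
    by (simp add: sum_distrib_left mult.assoc)
  also have "\<dots> = (\<Sum>k\<in>J. (\<Sum>j\<in>J. M i j * inverse_on J M j k) * y k)"
    by (subst sum.swap) (simp add: sum_distrib_right)
  also have "\<dots> = (\<Sum>k\<in>J. (if i = k then 1 else 0) * y k)"
    using W assms(3) unfolding is_inverse_on_def by (intro sum.cong) auto
  also have "\<dots> = y i"
    using assms(2,3) by (simp add: if_distrib[of "\<lambda>r. r * _"] sum.delta cong: if_cong)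
  finally show ?thesis .
qed

section \<open>Optimality conditions\<close>

lemma symmetric_matrix_inner:
  fixes Q :: "real^'n^'n"
  assumes "transpose Q = Q"
  shows "(Q *v x) \<bullet> y = x \<bullet> (Q *v y)"
  by (metis assms dot_lmul_matrix vector_transpose_matrix)

lemma psd_form_eq_0:
  fixes Q :: "real^'n^'n"
  assumes "transpose Q = Q" "pos_semidef Q" "x \<bullet> (Q *v x) = 0"
  shows "Q *v x = 0"
proof -
  define w where "w = Q *v x"
  define g where "g = w \<bullet> (Q *v w)"
  have g0: "0 \<le> g"
    using assms(2) by (simp add: pos_semidef_def g_def)
  have "(x - s *\<^sub>R w) \<bullet> (Q *v (x - s *\<^sub>R w)) = s\<^sup>2 * g - 2 * s * (w \<bullet> w)" for s
    using symmetric_matrix_inner[OF assms(1), of x w] assms(3)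
    by (simp add: matrix_vector_mult_diff_distrib matrix_vector_mult_scaleR inner_diff_left
        inner_diff_right w_def[symmetric] g_def inner_commute power2_eq_square algebra_simps)
  then have pos: "0 \<le> s\<^sup>2 * g - 2 * s * (w \<bullet> w)" for s
    using assms(2) unfolding pos_semidef_def by metis
  have "w \<bullet> w \<le> 0"
  proof (rule ccontr)
    assume "\<not> w \<bullet> w \<le> 0"
    \<comment> \<open>Adding 1 allows \<open>g = 0\<close>; the choice makes the quadratic term at
      most half of the linear one.\<close>
    define s where "s = (w \<bullet> w) / (g + 1)"
    have s: "0 < s"
      using \<open>\<not> w \<bullet> w \<le> 0\<close> g0 unfolding s_def by (intro divide_pos_pos) auto
    have "s * g \<le> w \<bullet> w"
      using g0 by (simp add: s_def field_simps)
    then have "s * (s * g) \<le> s * (w \<bullet> w)"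
      using s by simp
    moreover have "0 < s * (w \<bullet> w)"
      using s \<open>\<not> w \<bullet> w \<le> 0\<close> by (intro mult_pos_pos) auto
    ultimately show False
      using pos[of s] by (simp add: power2_eq_square)
  qed
  then have "w = 0"
    by (metis inner_eq_zero_iff inner_ge_zero order_antisym)
  then show ?thesis
    by (simp add: w_def)
qed

lemma qp_argmin_iff:
  "x \<in> qp_argmin Q a (c, b) \<longleftrightarrow>
    x \<in> feasible a b \<and> (\<forall>y\<in>feasible a b. qp_objective Q c x \<le> qp_objective Q c y)"
  by (auto simp: qp_argmin_def is_arg_min_linorder)

lemma qp_objective_add:
  assumes "transpose Q = Q"
  shows "qp_objective Q c (x + u) =
    qp_objective Q c x + (Q *v x + c) \<bullet> u + 1/2 * (u \<bullet> (Q *v u))"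
  using symmetric_matrix_inner[OF assms, of x u]
  by (simp add: qp_objective_def matrix_vector_right_distrib inner_add_left inner_add_right
      inner_commute algebra_simps)

lemma qp_objective_convex:
  assumes "transpose Q = Q" "pos_semidef Q" "0 \<le> t" "t \<le> 1"
  shows "qp_objective Q c ((1 - t) *\<^sub>R x + t *\<^sub>R z)
    \<le> (1 - t) * qp_objective Q c x + t * qp_objective Q c z"
proof -
  define u where "u = z - x"
  have z: "z = x + u" and w: "(1 - t) *\<^sub>R x + t *\<^sub>R z = x + t *\<^sub>R u"
    by (simp_all add: u_def algebra_simps)
  \<comment> \<open>In the expansion around \<open>x\<close> the two sides differ only in the
    quadratic term, with factor \<open>t * t\<close> on the left and \<open>t\<close> on the
    right.\<close>
  have "t * t \<le> t"
    using assms(3,4) mult_left_le by blast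
  then have "t * t * (u \<bullet> (Q *v u)) \<le> t * (u \<bullet> (Q *v u))"
    using assms(2) by (intro mult_right_mono) (auto simp: pos_semidef_def)
  then show ?thesis
    unfolding w unfolding z qp_objective_add[OF assms(1)]
    by (simp add: matrix_vector_mult_scaleR algebra_simps)
qed

lemma continuous_on_qp_objective [continuous_intros]:
  assumes "continuous_on S f" "continuous_on S g"
  shows "continuous_on S (\<lambda>x. qp_objective Q (f x) (g x))"
  unfolding qp_objective_def
  by (intro continuous_intros assms bounded_linear.continuous_on[OF matrix_vector_mul_bounded_linear assms(2)])

text \<open>Activity of \<open>D\<close> at \<open>x\<close> turns the gradient term into slacks of
  \<open>y\<close>. Being an exact identity, it serves twice: for nonnegative \<open>l\<close> and
  feasible \<open>y\<close> both corrections are nonnegative, which proves optimality, and equal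
  objective values make both vanish, which drives the uniqueness argument.\<close>

lemma kkt_objective_gap:
  fixes Q :: "real^'n^'n" and a :: "'m::finite \<Rightarrow> real^'n"
  assumes "transpose Q = Q"
    and "D \<subseteq> active a b x"
    and "- (Q *v x + c) = (\<Sum>i\<in>D. l i *\<^sub>R a i)"
  shows "qp_objective Q c y = qp_objective Q c x + (\<Sum>i\<in>D. l i * (b $ i - a i \<bullet> y))
    + 1/2 * ((y - x) \<bullet> (Q *v (y - x)))"
proof -
  have "(Q *v x + c) \<bullet> (y - x) = - (\<Sum>i\<in>D. l i *\<^sub>R a i) \<bullet> (y - x)"
    using assms(3) by (metis minus_minus)
  also have "\<dots> = (\<Sum>i\<in>D. l i * (a i \<bullet> x - a i \<bullet> y))"
    by (simp add: inner_sum_left inner_diff_right sum_subtractf right_diff_distrib)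
  also have "\<dots> = (\<Sum>i\<in>D. l i * (b $ i - a i \<bullet> y))"
    using assms(2) by (intro sum.cong) (auto simp: active_def)
  finally show ?thesis
    using qp_objective_add[OF assms(1), of c x "y - x"] by simp
qed

lemma kkt_sufficient:
  fixes Q :: "real^'n^'n" and a :: "'m::finite \<Rightarrow> real^'n"
  assumes "transpose Q = Q" "pos_semidef Q"
    and "x \<in> feasible a b" "D \<subseteq> active a b x" "kkt_set Q a c x D"
  shows "x \<in> qp_argmin Q a (c, b)"
  unfolding qp_argmin_iff
proof (intro conjI ballI)
  fix y assume y: "y \<in> feasible a b"
  obtain l where l: "\<forall>i\<in>D. 0 \<le> l i" "- (Q *v x + c) = (\<Sum>i\<in>D. l i *\<^sub>R a i)"
    using assms(5) unfolding kkt_set_def by (subst (asm) convex_cone_hull_image_iff) auto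
  have "0 \<le> (\<Sum>i\<in>D. l i * (b $ i - a i \<bullet> y))"
    using y l(1) by (intro sum_nonneg) (auto simp: feasible_def)
  moreover have "0 \<le> (y - x) \<bullet> (Q *v (y - x))"
    using assms(2) by (simp add: pos_semidef_def)
  ultimately show "qp_objective Q c x \<le> qp_objective Q c y"
    using kkt_objective_gap[OF assms(1,4) l(2), of y] by simp
qed (fact assms(3))

text \<open>Separation of the negative gradient from the closed cone of active normals, followed by
  a step along the separating direction that is short enough for the inactive constraints and for
  the curvature of the objective.\<close>

lemma kkt_necessary:
  fixes Q :: "real^'n^'n" and a :: "'m::finite \<Rightarrow> real^'n"
  assumes "transpose Q = Q" "x \<in> qp_argmin Q a (c, b)"
  shows "kkt_set Q a c x (active a b x)"
proof (rule ccontr)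
  define K where "K = convex_cone hull (a ` active a b x)"
  define g where "g = Q *v x + c"
  assume "\<not> kkt_set Q a c x (active a b x)"
  then have "- g \<notin> K"
    by (simp add: kkt_set_def K_def g_def)
  moreover have "convex K" "closed K"
    unfolding K_def by (auto intro: convex_convex_cone_hull closed_convex_cone_hull)
  ultimately obtain d r where dr: "d \<bullet> (- g) < r" "\<And>y. y \<in> K \<Longrightarrow> r < d \<bullet> y"
    using separating_hyperplane_closed_point[of K "- g"] by blast
  have r0: "r < 0"
    using dr(2)[of 0] by (simp add: K_def convex_cone_hull_contains_0)
  have act: "0 \<le> d \<bullet> a i" if "i \<in> active a b x" for i
  proof (rule ccontr)
    assume neg: "\<not> 0 \<le> d \<bullet> a i"
    \<comment> \<open>This point of the ray has inner product exactly \<open>r\<close> with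
      \<open>d\<close>, against the strict bound on the cone.\<close>
    have "(r / (d \<bullet> a i)) *\<^sub>R a i \<in> K"
      unfolding K_def using that neg r0
      by (intro convex_cone_hull_mul hull_inc) (auto simp: divide_nonpos_neg)
    from dr(2)[OF this] neg show False by simp
  qed
  \<comment> \<open>so \<open>- d\<close> is a feasible direction of descent\<close>
  have descent: "0 < d \<bullet> g"
    using dr(1) r0 by simp
  have "\<forall>i. \<exists>e>0. \<forall>s. 0 \<le> s \<longrightarrow> s \<le> e \<longrightarrow> a i \<bullet> (x + s *\<^sub>R (- d)) \<le> b $ i"
  proof
    fix i
    have fx: "a i \<bullet> x \<le> b $ i"
      using assms(2) by (simp add: qp_argmin_iff feasible_def)
    show "\<exists>e>0. \<forall>s. 0 \<le> s \<longrightarrow> s \<le> e \<longrightarrow> a i \<bullet> (x + s *\<^sub>R (- d)) \<le> b $ i"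
    proof (cases "i \<in> active a b x")
      case True
      then show ?thesis
        using act[OF True] fx
        by (intro exI[of _ 1]) (auto simp: inner_diff_right inner_commute[of "a i" d] intro: order_trans[rotated])
    next
      case False
      \<comment> \<open>Slack divided by the speed of the constraint; adding 1 keeps the denominator
        positive.\<close>
      define e where "e = (b $ i - a i \<bullet> x) / (\<bar>a i \<bullet> d\<bar> + 1)"
      have e: "0 < e"
        using False fx by (auto simp: e_def active_def intro!: divide_pos_pos)
      have "a i \<bullet> (x + s *\<^sub>R (- d)) \<le> b $ i" if "0 \<le> s" "s \<le> e" for s
      proof -
        have "s * (- (a i \<bullet> d)) \<le> s * (\<bar>a i \<bullet> d\<bar> + 1)"
          using that by (intro mult_left_mono) auto
        also have "\<dots> \<le> e * (\<bar>a i \<bullet> d\<bar> + 1)"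
          using that by (intro mult_right_mono) auto
        also have "\<dots> = b $ i - a i \<bullet> x"
          by (simp add: e_def)
        finally show ?thesis by (simp add: inner_diff_right)
      qed
      then show ?thesis using e by blast
    qed
  qed
  then obtain e where e: "\<And>i. 0 < e i"
    "\<And>i s. 0 \<le> s \<Longrightarrow> s \<le> e i \<Longrightarrow> a i \<bullet> (x + s *\<^sub>R (- d)) \<le> b $ i"
    by metis
  define q where "q = d \<bullet> (Q *v d)"
  \<comment> \<open>The second bound limits the curvature term to half of the first-order
    decrease.\<close>
  define s where "s = min (Min (range e)) ((d \<bullet> g) / (\<bar>q\<bar> + 1))"
  have "0 < Min (range e)"
    using e(1) by (subst Min_gr_iff) auto
  then have s: "0 < s" "\<And>i. s \<le> e i"
    using descent by (auto simp: s_def min_le_iff_disj intro!: divide_pos_pos)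
  have "x + s *\<^sub>R (- d) \<in> feasible a b"
    using e(2) s by (simp add: feasible_def less_imp_le)
  then have "qp_objective Q c x \<le> qp_objective Q c (x + s *\<^sub>R (- d))"
    using assms(2) by (simp add: qp_argmin_iff)
  then have "s * (d \<bullet> g) \<le> 1/2 * (s * (s * q))"
    using qp_objective_add[OF assms(1), of c x "(- s) *\<^sub>R d"]
    by (simp add: matrix_vector_mult_scaleR[of Q "- s" d, simplified] g_def[symmetric] q_def inner_commute)
  then have "d \<bullet> g \<le> 1/2 * (s * q)"
    using s(1) by (simp add: field_simps)
  moreover have "s * q \<le> s * (\<bar>q\<bar> + 1)"
    using s(1) by (intro mult_left_mono) auto
  moreover have "s * (\<bar>q\<bar> + 1) \<le> d \<bullet> g"
  proof -
    have "s \<le> (d \<bullet> g) / (\<bar>q\<bar> + 1)" by (simp add: s_def)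
    then show ?thesis by (simp add: pos_le_divide_eq)
  qed
  ultimately show False using descent by linarith
qed

section \<open>The KKT matrix, its kernel and its inverse\<close>

text \<open>Translates the kernel over \<open>UNIV <+> D\<close> into vector equations, so that
  later arguments need only a vector \<open>x\<close> and multipliers \<open>m\<close>.\<close>

lemma nonsingular_kkt_iff:
  fixes Q :: "real^'n^'n" and a :: "'m::finite \<Rightarrow> real^'n"
  shows "nonsingular_on (UNIV <+> D) (kkt_matrix Q a) \<longleftrightarrow>
    (\<forall>x m. Q *v x + (\<Sum>i\<in>D. m i *\<^sub>R a i) = 0 \<and> (\<forall>i\<in>D. a i \<bullet> x = 0) \<longrightarrow>
      x = 0 \<and> (\<forall>i\<in>D. m i = 0))"
proof -
  have rows: "(\<forall>i\<in>UNIV <+> D. (\<Sum>k\<in>UNIV <+> D. kkt_matrix Q a i k * v k) = 0) \<longleftrightarrow>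
      Q *v (\<chi> j. v (Inl j)) + (\<Sum>i\<in>D. v (Inr i) *\<^sub>R a i) = 0 \<and>
      (\<forall>i\<in>D. a i \<bullet> (\<chi> j. v (Inl j)) = 0)" for v
  proof -
    have "(\<forall>i\<in>UNIV <+> D. P i) \<longleftrightarrow> (\<forall>j. P (Inl j)) \<and> (\<forall>i\<in>D. P (Inr i))" for P :: "'n + 'm \<Rightarrow> bool"
      by auto
    then show ?thesis
      by (simp add: sum.Plus vec_eq_iff matrix_vector_mult_def inner_vec_def mult.commute)
  qed
  show ?thesis
    unfolding nonsingular_on_iff_kernel rows
  proof (intro iffI allI impI)
    fix x m
    assume ker: "\<forall>v. Q *v (\<chi> j. v (Inl j)) + (\<Sum>i\<in>D. v (Inr i) *\<^sub>R a i) = 0 \<and>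
      (\<forall>i\<in>D. a i \<bullet> (\<chi> j. v (Inl j)) = 0) \<longrightarrow> (\<forall>k\<in>UNIV <+> D. v k = 0)"
      and *: "Q *v x + (\<Sum>i\<in>D. m i *\<^sub>R a i) = 0 \<and> (\<forall>i\<in>D. a i \<bullet> x = 0)"
    define v where "v k = (case k of Inl j \<Rightarrow> x $ j | Inr i \<Rightarrow> m i)" for k
    have "\<forall>k\<in>UNIV <+> D. v k = 0"
      using ker[rule_format, of v] * by (auto simp: v_def)
    then have "v (Inl j) = 0" "i \<in> D \<Longrightarrow> v (Inr i) = 0" for i j
      by auto
    then show "x = 0 \<and> (\<forall>i\<in>D. m i = 0)"
      by (simp add: v_def vec_eq_iff)
  next
    fix v
    assume ker: "\<forall>x m. Q *v x + (\<Sum>i\<in>D. m i *\<^sub>R a i) = 0 \<and> (\<forall>i\<in>D. a i \<bullet> x = 0) \<longrightarrow>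
        x = 0 \<and> (\<forall>i\<in>D. m i = 0)"
      and *: "Q *v (\<chi> j. v (Inl j)) + (\<Sum>i\<in>D. v (Inr i) *\<^sub>R a i) = 0 \<and>
      (\<forall>i\<in>D. a i \<bullet> (\<chi> j. v (Inl j)) = 0)"
    show "\<forall>k\<in>UNIV <+> D. v k = 0"
      using ker[rule_format, OF *] by (auto simp: vec_eq_iff)
  qed
qed

text \<open>The bottom block annihilates the multiplier terms in the inner product of the top block
  with \<open>x\<close>, so the quadratic form vanishes and \<open>Q *v x = 0\<close>; independence
  then removes the multipliers.\<close>

lemma nonsingular_kkt_iff_independent:
  fixes Q :: "real^'n^'n" and a :: "'m::finite \<Rightarrow> real^'n"
  assumes "transpose Q = Q" "pos_semidef Q" "independent_family a D"
  shows "nonsingular_on (UNIV <+> D) (kkt_matrix Q a) \<longleftrightarrow>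
    (\<forall>x. Q *v x = 0 \<and> (\<forall>i\<in>D. a i \<bullet> x = 0) \<longrightarrow> x = 0)"
  unfolding nonsingular_kkt_iff
proof (intro iffI allI impI)
  fix x
  assume ker: "\<forall>x m. Q *v x + (\<Sum>i\<in>D. m i *\<^sub>R a i) = 0 \<and> (\<forall>i\<in>D. a i \<bullet> x = 0) \<longrightarrow>
        x = 0 \<and> (\<forall>i\<in>D. m i = 0)"
    and "Q *v x = 0 \<and> (\<forall>i\<in>D. a i \<bullet> x = 0)"
  then show "x = 0"
    using ker[rule_format, of x "\<lambda>_. 0"] by simp
next
  fix x m
  assume ker: "\<forall>x. Q *v x = 0 \<and> (\<forall>i\<in>D. a i \<bullet> x = 0) \<longrightarrow> x = 0"
    and *: "Q *v x + (\<Sum>i\<in>D. m i *\<^sub>R a i) = 0 \<and> (\<forall>i\<in>D. a i \<bullet> x = 0)"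
  have "x \<bullet> (Q *v x) = x \<bullet> (- (\<Sum>i\<in>D. m i *\<^sub>R a i))"
    using * by (metis add_eq_0_iff2)
  also have "\<dots> = 0"
    using * by (simp add: inner_sum_right inner_commute)
  finally have "Q *v x = 0"
    by (rule psd_form_eq_0[OF assms(1,2)])
  then show "x = 0 \<and> (\<forall>i\<in>D. m i = 0)"
    using ker * assms(3) by (auto simp: independent_family_def)
qed

text \<open>Strict positivity of the multipliers is the point: a second minimizer must have zero
  slack on all of \<open>D\<close>, so its difference to \<open>x\<close>, taken with zero
  multipliers, lies in the kernel of the KKT matrix.\<close>

lemma kkt_unique:
  fixes Q :: "real^'n^'n" and a :: "'m::finite \<Rightarrow> real^'n"
  assumes "transpose Q = Q" "pos_semidef Q"
    and "x \<in> feasible a b" "D \<subseteq> active a b x"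
    and l: "- (Q *v x + c) = (\<Sum>i\<in>D. l i *\<^sub>R a i)" "\<And>i. i \<in> D \<Longrightarrow> 0 < l i"
    and nonsing: "nonsingular_on (UNIV <+> D) (kkt_matrix Q a)"
  shows "qp_argmin Q a (c, b) = {x}"
proof
  have "kkt_set Q a c x D"
    unfolding kkt_set_def using l
    by (subst convex_cone_hull_image_iff) (auto intro!: exI[of _ l] less_imp_le)
  then have x: "x \<in> qp_argmin Q a (c, b)"
    using assms kkt_sufficient by blast
  then show "{x} \<subseteq> qp_argmin Q a (c, b)" by simp
  show "qp_argmin Q a (c, b) \<subseteq> {x}"
  proof
    fix y assume y: "y \<in> qp_argmin Q a (c, b)"
    have fy: "y \<in> feasible a b" and le: "qp_objective Q c y \<le> qp_objective Q c x"
      using x y by (auto simp: qp_argmin_iff)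
    have terms: "\<And>i. i \<in> D \<Longrightarrow> 0 \<le> l i * (b $ i - a i \<bullet> y)"
      using fy l(2) by (simp add: feasible_def less_imp_le)
    have psd: "0 \<le> (y - x) \<bullet> (Q *v (y - x))"
      using assms(2) by (simp add: pos_semidef_def)
    have "0 \<le> (\<Sum>i\<in>D. l i * (b $ i - a i \<bullet> y))"
      by (intro sum_nonneg terms)
    then have "(\<Sum>i\<in>D. l i * (b $ i - a i \<bullet> y)) = 0" "(y - x) \<bullet> (Q *v (y - x)) = 0"
      using le psd kkt_objective_gap[OF assms(1,4) l(1), of y] by auto
    then have "\<forall>i\<in>D. l i * (b $ i - a i \<bullet> y) = 0" and Q0: "Q *v (y - x) = 0"
      using terms by (auto simp: sum_nonneg_eq_0_iff psd_form_eq_0[OF assms(1,2)])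
    then have "\<forall>i\<in>D. a i \<bullet> y = b $ i"
      using l(2) by fastforce
    then have "\<forall>i\<in>D. a i \<bullet> (y - x) = 0"
      using assms(4) by (auto simp: inner_diff_right active_def)
    then have "y - x = 0"
      using nonsing[unfolded nonsingular_kkt_iff, rule_format, of "y - x" "\<lambda>_. 0"] Q0 by simp
    then show "y \<in> {x}" by simp
  qed
qed

text \<open>\<open>m\<close> is the bottom block of the solution, which
  \<open>kkt_inverse_top\<close> drops.\<close>

lemma kkt_inverse_top_solves:
  fixes Q :: "real^'n^'n" and a :: "'m::finite \<Rightarrow> real^'n"
  assumes "nonsingular_on (UNIV <+> D) (kkt_matrix Q a)"
  obtains m where "Q *v kkt_inverse_top Q a D \<alpha> \<beta> + (\<Sum>i\<in>D. m i *\<^sub>R a i) = \<alpha>"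
    "\<And>i. i \<in> D \<Longrightarrow> a i \<bullet> kkt_inverse_top Q a D \<alpha> \<beta> = \<beta> $ i"
proof -
  let ?J = "UNIV <+> D"
  define y where "y k = (case k of Inl l \<Rightarrow> \<alpha> $ l | Inr i \<Rightarrow> \<beta> $ i)" for k
  define z where "z j = (\<Sum>k\<in>?J. inverse_on ?J (kkt_matrix Q a) j k * y k)" for j
  have top: "kkt_inverse_top Q a D \<alpha> \<beta> = (\<chi> j. z (Inl j))"
    by (simp add: kkt_inverse_top_def z_def y_def)
  have *: "(\<Sum>j\<in>?J. kkt_matrix Q a i j * z j) = y i" if "i \<in> ?J" for i
    unfolding z_def using assms that by (intro inverse_on_solves) auto
  show thesis
  proof
    show "Q *v kkt_inverse_top Q a D \<alpha> \<beta> + (\<Sum>i\<in>D. z (Inr i) *\<^sub>R a i) = \<alpha>"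
      using *[OF InlI[OF UNIV_I]] unfolding top
      by (simp add: sum.Plus vec_eq_iff matrix_vector_mult_def y_def mult.commute)
    show "a i \<bullet> kkt_inverse_top Q a D \<alpha> \<beta> = \<beta> $ i" if "i \<in> D" for i
      using *[OF InrI[OF that]] that unfolding top
      by (simp add: sum.Plus inner_vec_def y_def)
  qed
qed

lemma kkt_inverse_top_eqI:
  fixes Q :: "real^'n^'n" and a :: "'m::finite \<Rightarrow> real^'n"
  assumes "nonsingular_on (UNIV <+> D) (kkt_matrix Q a)"
    and "Q *v x + (\<Sum>i\<in>D. l i *\<^sub>R a i) = \<alpha>" "\<And>i. i \<in> D \<Longrightarrow> a i \<bullet> x = \<beta> $ i"
  shows "kkt_inverse_top Q a D \<alpha> \<beta> = x"
proof -
  let ?u = "kkt_inverse_top Q a D \<alpha> \<beta>"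
  obtain m where m: "Q *v ?u + (\<Sum>i\<in>D. m i *\<^sub>R a i) = \<alpha>" "\<And>i. i \<in> D \<Longrightarrow> a i \<bullet> ?u = \<beta> $ i"
    using kkt_inverse_top_solves[OF assms(1)] by blast
  have "Q *v (?u - x) + (\<Sum>i\<in>D. (m i - l i) *\<^sub>R a i) = 0"
    using m(1) assms(2)
    by (simp add: matrix_vector_mult_diff_distrib scaleR_left_diff_distrib sum_subtractf algebra_simps)
  moreover have "\<forall>i\<in>D. a i \<bullet> (?u - x) = 0"
    using m(2) assms(3) by (simp add: inner_diff_right)
  ultimately have "?u - x = 0"
    using assms(1)[unfolded nonsingular_kkt_iff, rule_format, of "?u - x" "\<lambda>i. m i - l i"] by blast
  then show ?thesis by simp
qed

lemma linear_kkt_inverse_top: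
  fixes Q :: "real^'n^'n" and a :: "'m::finite \<Rightarrow> real^'n"
  shows "linear (\<lambda>p. kkt_inverse_top Q a D (fst p) (snd p))"
  by (rule linearI)
    (auto simp: kkt_inverse_top_def vec_eq_iff sum.Plus sum.distrib sum_distrib_left algebra_simps)

section \<open>Norms\<close>

lemma is_norm_zero: "is_norm N \<Longrightarrow> N 0 = 0"
  unfolding is_norm_def by blast

text \<open>Norm equivalence: expansion in the coordinate basis bounds \<open>N\<close> from above
  and makes it Lipschitz, so it attains a positive minimum on the Euclidean unit sphere, and scaling
  gives the lower bound.\<close>

lemma is_norm_bounds:
  fixes N :: "real^'n \<Rightarrow> real"
  assumes "is_norm N"
  obtains e C where "0 < e" "0 < C" "\<And>x. e * norm x \<le> N x" "\<And>x. N x \<le> C * norm x"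
proof -
  have N: "\<And>x. 0 \<le> N x" "\<And>x. N x = 0 \<longleftrightarrow> x = 0" "\<And>r x. N (r *\<^sub>R x) = \<bar>r\<bar> * N x"
    "\<And>x y. N (x + y) \<le> N x + N y"
    using assms unfolding is_norm_def by blast+
  define C where "C = (\<Sum>j\<in>UNIV. N (axis j 1)) + 1"
  have C: "0 < C"
    unfolding C_def by (intro add_nonneg_pos sum_nonneg) (auto simp: N)
  have Nsum: "N (\<Sum>j\<in>A. g j) \<le> (\<Sum>j\<in>A. N (g j))" if "finite A" for A :: "'n set" and g
    using that
  proof (induction A)
    case (insert j A)
    then show ?case using N(4)[of "g j" "sum g A"] by simp
  qed (simp add: is_norm_zero[OF assms])
  have up: "N x \<le> C * norm x" for x
  proof -
    have "N x = N (\<Sum>j\<in>UNIV. x $ j *\<^sub>R axis j 1)"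
      by (simp only: basis_expansion flip: scalar_mult_eq_scaleR)
    also have "\<dots> \<le> (\<Sum>j\<in>UNIV. \<bar>x $ j\<bar> * N (axis j 1))"
      using Nsum[of UNIV "\<lambda>j. x $ j *\<^sub>R axis j 1"] by (simp add: N)
    also have "\<dots> \<le> (\<Sum>j\<in>UNIV. norm x * N (axis j 1))"
      by (intro sum_mono mult_right_mono component_le_norm_cart N)
    also have "\<dots> \<le> C * norm x"
      by (simp add: C_def sum_distrib_left[symmetric] algebra_simps)
    finally show ?thesis .
  qed
  have diff: "\<bar>N x - N y\<bar> \<le> C * norm (x - y)" for x y
    using N(4)[of "x - y" y] N(4)[of "y - x" x] up[of "x - y"] up[of "y - x"]
    by (simp add: norm_minus_commute)
  have "C-lipschitz_on (sphere 0 1) N"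
    using C diff by (intro lipschitz_onI) (auto simp: dist_norm)
  then have "continuous_on (sphere 0 1) N"
    by (rule lipschitz_on_continuous_on)
  moreover have "sphere (0::real^'n) 1 \<noteq> {}"
    by simp
  ultimately obtain w where w: "w \<in> sphere 0 1" "\<And>x. x \<in> sphere 0 1 \<Longrightarrow> N w \<le> N x"
    using continuous_attains_inf[OF compact_sphere] by metis
  have "N w * norm x \<le> N x" for x
  proof (cases "x = 0")
    case False
    then have "N w \<le> N ((1 / norm x) *\<^sub>R x)"
      by (intro w(2)) simp
    then show ?thesis using False by (simp add: N field_simps)
  qed (simp add: N)
  moreover have "0 < N w"
    using w(1) N(1)[of w] N(2)[of w] by (metis dist_0_norm mem_sphere norm_zero order_less_le zero_neq_one)
  ultimately show thesis
    using that C up by blast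
qed

text \<open>The real \<open>Sup\<close> is guaranteed to be an upper bound only for sets bounded
  above; here the lower bound on \<open>N\<close> confines its unit ball to a Euclidean
  ball.\<close>

lemma abs_inner_le_dual_norm:
  assumes "is_norm N" "N y \<le> 1"
  shows "\<bar>u \<bullet> y\<bar> \<le> dual_norm N u"
  unfolding dual_norm_def
proof (rule cSup_upper)
  obtain e where e: "0 < e" "\<And>x. e * norm x \<le> N x"
    using is_norm_bounds[OF assms(1)] by metis
  show "bdd_above {\<bar>u \<bullet> y\<bar> |y. N y \<le> 1}"
  proof (rule bdd_aboveI, clarify)
    fix y assume "N y \<le> 1"
    then have "norm y \<le> 1 / e"
      using e(1) e(2)[of y] by (simp add: field_simps)
    then show "\<bar>u \<bullet> y\<bar> \<le> norm u * (1 / e)"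
      by (meson Cauchy_Schwarz_ineq2 mult_left_mono norm_ge_zero order_trans)
  qed
qed (use assms in blast)

lemma dual_norm_least:
  assumes "is_norm N" "\<And>y. N y \<le> 1 \<Longrightarrow> \<bar>u \<bullet> y\<bar> \<le> r"
  shows "dual_norm N u \<le> r"
  unfolding dual_norm_def
proof (rule cSup_least)
  have "N 0 \<le> 1" using assms(1) by (simp add: is_norm_zero)
  then show "{\<bar>u \<bullet> y\<bar> |y. N y \<le> 1} \<noteq> {}" by blast
qed (use assms(2) in auto)

lemma dual_norm_nonneg:
  assumes "is_norm N"
  shows "0 \<le> dual_norm N u"
proof -
  have "N 0 \<le> 1" using assms by (simp add: is_norm_zero)
  then show ?thesis
    using abs_inner_le_dual_norm[OF assms, of 0 u] by simp
qed

text \<open>One inequality for all scalars suffices: applied to \<open>1 / r\<close> and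
  \<open>r *\<^sub>R u\<close> it gives the reverse.\<close>

lemma dual_norm_scaleR:
  assumes "is_norm N"
  shows "dual_norm N (r *\<^sub>R u) = \<bar>r\<bar> * dual_norm N u"
proof -
  have le: "dual_norm N (r *\<^sub>R u) \<le> \<bar>r\<bar> * dual_norm N u" for r u
    using assms
    by (intro dual_norm_least) (auto simp: abs_mult intro!: mult_left_mono abs_inner_le_dual_norm)
  show ?thesis
  proof (cases "r = 0")
    case True
    then show ?thesis using le[of 0 u] dual_norm_nonneg[OF assms, of 0] by simp
  next
    case False
    then have "dual_norm N u \<le> \<bar>1 / r\<bar> * dual_norm N (r *\<^sub>R u)"
      using le[of "1 / r" "r *\<^sub>R u"] by simp
    then show ?thesis using le[of r u] False by (simp add: field_simps)
  qed
qed

lemma norm_le_dual_norm: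
  fixes N :: "real^'n \<Rightarrow> real"
  assumes "is_norm N"
  obtains C where "0 < C" "\<And>u. norm u \<le> C * dual_norm N u"
proof -
  obtain C where C: "0 < C" "\<And>x. N x \<le> C * norm x"
    using is_norm_bounds[OF assms] by metis
  have "norm u \<le> C * dual_norm N u" for u
  proof (cases "u = 0")
    case True
    then show ?thesis using C(1) dual_norm_nonneg[OF assms, of u] by simp
  next
    case False
    \<comment> \<open>Scaled to have \<open>N y \<le> 1\<close> by the Euclidean bound; testing
      \<open>u\<close> with it yields \<open>norm u / C\<close>.\<close>
    define y where "y = (1 / (C * norm u)) *\<^sub>R u"
    have "N y \<le> 1"
      using assms C(1) C(2)[of u] False by (simp add: y_def is_norm_def field_simps)
    then have "\<bar>u \<bullet> y\<bar> \<le> dual_norm N u"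
      by (rule abs_inner_le_dual_norm[OF assms])
    moreover have "u \<bullet> y = norm u / C"
      using False C(1) by (simp add: y_def dot_square_norm power2_eq_square)
    ultimately show ?thesis using C(1) by (simp add: field_simps)
  qed
  then show thesis using that C(1) by blast
qed

lemma param_norm_scaleR:
  assumes "is_norm N"
  shows "param_norm N (r *\<^sub>R p) = \<bar>r\<bar> * param_norm N p"
  by (simp add: param_norm_def dual_norm_scaleR[OF assms] infnorm_mul max_mult_distrib_left)

lemma param_norm_nonneg:
  assumes "is_norm N"
  shows "0 \<le> param_norm N p"
  using dual_norm_nonneg[OF assms] by (simp add: param_norm_def le_max_iff_disj)

lemma param_norm_eq_0:
  assumes "is_norm N" "param_norm N p = 0"
  shows "p = 0"
proof -
  obtain C where C: "0 < C" "\<And>u. norm u \<le> C * dual_norm N u"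
    using norm_le_dual_norm[OF assms(1)] by metis
  have "dual_norm N (fst p) \<le> 0" "infnorm (snd p) \<le> 0"
    using assms(2) by (simp_all add: param_norm_def)
  then have "dual_norm N (fst p) = 0" "infnorm (snd p) = 0"
    using dual_norm_nonneg[OF assms(1)] infnorm_pos_le[of "snd p"] by (auto intro: order_antisym)
  then show ?thesis
    using C(2)[of "fst p"] by (simp add: prod_eq_iff infnorm_eq_0)
qed

text \<open>Makes the supremum defining \<open>kkt_inverse_norm\<close> an upper bound: the unit
  sphere of the parameter norm is bounded in the Euclidean norm, and the map is linear.\<close>

lemma bdd_above_kkt_inverse:
  fixes Q :: "real^'n^'n" and a :: "'m::finite \<Rightarrow> real^'n"
  assumes "is_norm N"
  shows "bdd_above {N (kkt_inverse_top Q a D \<alpha> \<beta>) | \<alpha> \<beta>.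
    (\<forall>i. i \<notin> D \<longrightarrow> \<beta> $ i = 0) \<and> max (dual_norm N \<alpha>) (infnorm \<beta>) = 1}"
proof -
  obtain C where C: "0 < C" "\<And>x. N x \<le> C * norm x"
    using is_norm_bounds[OF assms] by metis
  obtain B where B: "0 < B" "\<And>u. norm u \<le> B * dual_norm N u"
    using norm_le_dual_norm[OF assms] by metis
  obtain K where K: "0 < K" "\<And>p. norm (kkt_inverse_top Q a D (fst p) (snd p)) \<le> norm p * K"
    using bounded_linear.pos_bounded[OF linear_conv_bounded_linear[THEN iffD1, OF linear_kkt_inverse_top]]
    by blast
  show ?thesis
  proof (rule bdd_aboveI, clarify)
    fix \<alpha> :: "real^'n" and \<beta> :: "real^'m"
    assume "max (dual_norm N \<alpha>) (infnorm \<beta>) = 1"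
    then have 1: "dual_norm N \<alpha> \<le> 1" "infnorm \<beta> \<le> 1" by auto
    have "norm \<alpha> \<le> B"
      using B(2)[of \<alpha>] 1(1) B(1) by (meson mult_left_le less_imp_le order_trans)
    moreover have "norm \<beta> \<le> sqrt DIM(real^'m)"
      using norm_le_infnorm[of \<beta>] 1(2)
      by (meson mult_left_le order_trans real_sqrt_ge_zero of_nat_0_le_iff)
    ultimately have "norm (\<alpha>, \<beta>) \<le> B + sqrt DIM(real^'m)"
      using norm_Pair_le[of \<alpha> \<beta>] by linarith
    then have "norm (\<alpha>, \<beta>) * K \<le> (B + sqrt DIM(real^'m)) * K"
      using K(1) by (intro mult_right_mono) auto
    then have "norm (kkt_inverse_top Q a D \<alpha> \<beta>) \<le> (B + sqrt DIM(real^'m)) * K"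
      using K(2)[of "(\<alpha>, \<beta>)"] by (metis fst_conv order_trans snd_conv)
    then have "C * norm (kkt_inverse_top Q a D \<alpha> \<beta>) \<le> C * ((B + sqrt DIM(real^'m)) * K)"
      using C(1) by (intro mult_left_mono) auto
    then show "N (kkt_inverse_top Q a D \<alpha> \<beta>) \<le> C * ((B + sqrt DIM(real^'m)) * K)"
      using C(2) order_trans by blast
  qed
qed

text \<open>Index types are nonempty, so there is a coordinate vector to normalise. The resulting
  \<open>u\<close> keeps the set under the supremum in \<open>kkt_inverse_norm\<close>
  nonempty.\<close>

lemma dual_norm_unit_exists:
  fixes N :: "real^'n \<Rightarrow> real"
  assumes "is_norm N"
  obtains u where "dual_norm N u = 1"
proof -
  define v :: "real^'n" where "v = axis undefined 1"
  have "v \<noteq> 0" by (simp add: v_def)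
  obtain C where C: "\<And>u. norm u \<le> C * dual_norm N u"
    using norm_le_dual_norm[OF assms] by metis
  have "dual_norm N v \<noteq> 0"
    using C[of v] \<open>v \<noteq> 0\<close> by auto
  then have "dual_norm N ((1 / dual_norm N v) *\<^sub>R v) = 1"
    using dual_norm_nonneg[OF assms, of v] by (simp add: dual_norm_scaleR[OF assms])
  then show thesis using that by blast
qed

lemma kkt_inverse_norm_nonneg:
  fixes Q :: "real^'n^'n" and a :: "'m::finite \<Rightarrow> real^'n"
  assumes "is_norm N"
  shows "0 \<le> kkt_inverse_norm N Q a D"
proof -
  obtain u where u: "dual_norm N u = 1"
    using dual_norm_unit_exists[OF assms] .
  have "N (kkt_inverse_top Q a D u 0) \<le> kkt_inverse_norm N Q a D"
    unfolding kkt_inverse_norm_def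
  proof (rule cSup_upper[OF _ bdd_above_kkt_inverse[OF assms]], rule CollectI)
    show "\<exists>\<alpha> \<beta>. N (kkt_inverse_top Q a D u 0) = N (kkt_inverse_top Q a D \<alpha> \<beta>) \<and>
      (\<forall>i. i \<notin> D \<longrightarrow> \<beta> $ i = 0) \<and> max (dual_norm N \<alpha>) (infnorm \<beta>) = 1"
      using u by (intro exI[of _ u] exI[of _ 0]) (simp add: infnorm_0)
  qed
  moreover have "0 \<le> N (kkt_inverse_top Q a D u 0)"
    using assms by (simp add: is_norm_def)
  ultimately show ?thesis by linarith
qed

lemma kkt_inverse_norm_bound:
  fixes Q :: "real^'n^'n" and a :: "'m::finite \<Rightarrow> real^'n"
  assumes "is_norm N"
  shows "N (kkt_inverse_top Q a D \<alpha> \<beta>) \<le> kkt_inverse_norm N Q a D * param_norm N (\<alpha>, \<beta>)"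
proof -
  have N: "\<And>x. 0 \<le> N x" "N 0 = 0" "\<And>r x. N (r *\<^sub>R x) = \<bar>r\<bar> * N x"
    using assms unfolding is_norm_def by auto
  \<comment> \<open>The supremum ranges only over vectors vanishing off \<open>D\<close>; truncation
    leaves the image unchanged and does not increase the parameter norm.\<close>
  define \<beta>' where "\<beta>' = (\<chi> i. if i \<in> D then \<beta> $ i else 0)"
  have top: "kkt_inverse_top Q a D \<alpha> \<beta> = kkt_inverse_top Q a D \<alpha> \<beta>'"
    by (simp add: kkt_inverse_top_def vec_eq_iff sum.Plus \<beta>'_def)
  have "infnorm \<beta>' \<le> infnorm \<beta>"
    unfolding infnorm_Max[of \<beta>']
  proof (rule Max.boundedI)
    fix r assume "r \<in> (\<lambda>i. \<bar>\<beta>' \<bullet> i\<bar>) ` Basis"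
    then obtain k where "r = \<bar>\<beta>' $ k\<bar>"
      by (auto simp: Basis_vec_def inner_axis)
    then show "r \<le> infnorm \<beta>"
      using component_le_infnorm_cart[of \<beta> k] infnorm_pos_le[of \<beta>] by (simp add: \<beta>'_def)
  qed auto
  define r where "r = param_norm N (\<alpha>, \<beta>')"
  have r: "0 \<le> r" "r \<le> param_norm N (\<alpha>, \<beta>)"
    using \<open>infnorm \<beta>' \<le> infnorm \<beta>\<close> param_norm_nonneg[OF assms]
    by (auto simp: r_def param_norm_def)
  have scale: "kkt_inverse_top Q a D (s *\<^sub>R \<alpha>) (s *\<^sub>R \<beta>') = s *\<^sub>R kkt_inverse_top Q a D \<alpha> \<beta>'" for s
    using linear_cmul[OF linear_kkt_inverse_top, of Q a D s "(\<alpha>, \<beta>')"] by simp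
  show ?thesis
  proof (cases "r = 0")
    case True
    then have "(\<alpha>, \<beta>') = 0"
      using param_norm_eq_0[OF assms, of "(\<alpha>, \<beta>')"] r_def by metis
    then have "\<alpha> = 0" "\<beta>' = 0"
      by (simp_all add: zero_prod_def)
    then have "kkt_inverse_top Q a D \<alpha> \<beta> = 0"
      using scale[of 0] unfolding top by simp
    then show ?thesis
      using kkt_inverse_norm_nonneg[OF assms, of Q a D] param_norm_nonneg[OF assms, of "(\<alpha>, \<beta>)"]
      by (simp add: N)
  next
    case False
    have unit: "max (dual_norm N ((1 / r) *\<^sub>R \<alpha>)) (infnorm ((1 / r) *\<^sub>R \<beta>')) = 1"
      using param_norm_scaleR[OF assms, of "1 / r" "(\<alpha>, \<beta>')"] False r(1)
      by (simp add: r_def[symmetric]) (simp add: param_norm_def)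
    have "N (kkt_inverse_top Q a D ((1 / r) *\<^sub>R \<alpha>) ((1 / r) *\<^sub>R \<beta>')) \<le> kkt_inverse_norm N Q a D"
      unfolding kkt_inverse_norm_def
      by (rule cSup_upper[OF _ bdd_above_kkt_inverse[OF assms]])
        (use unit in \<open>auto simp: \<beta>'_def intro!: exI[of _ "(1 / r) *\<^sub>R \<alpha>"] exI[of _ "(1 / r) *\<^sub>R \<beta>'"]\<close>)
    then have "N (kkt_inverse_top Q a D \<alpha> \<beta>) \<le> r * kkt_inverse_norm N Q a D"
      unfolding scale using False r(1) by (simp add: N top field_simps)
    also have "\<dots> \<le> param_norm N (\<alpha>, \<beta>) * kkt_inverse_norm N Q a D"
      using r(2) kkt_inverse_norm_nonneg[OF assms] by (rule mult_right_mono)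
    finally show ?thesis
      by (simp add: mult.commute)
  qed
qed

text \<open>The jump from \<open>s\<close> to the last point \<open>r\<close> of a piece containing
  \<open>s\<close> leaves that piece behind for good, so the induction continues on
  \<open>{r..t}\<close> with one piece fewer. The bounds add up to \<open>L * (t - s)\<close>
  however many pieces there are.\<close>

lemma closed_cover_lipschitz:
  fixes f :: "real \<Rightarrow> real^'n"
  assumes "is_norm N" "finite K" "s \<le> t"
    and "\<And>i. i \<in> K \<Longrightarrow> closed (T i)" "{s..t} \<subseteq> (\<Union>i\<in>K. T i)"
    and "\<And>i x y. i \<in> K \<Longrightarrow> x \<in> T i \<Longrightarrow> y \<in> T i \<Longrightarrow> x \<le> y \<Longrightarrow> s \<le> x \<Longrightarrow> y \<le> t \<Longrightarrow>
      N (f x - f y) \<le> L * (y - x)"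
  shows "N (f s - f t) \<le> L * (t - s)"
  using assms(2-)
proof (induction K arbitrary: s rule: finite_psubset_induct)
  case (psubset K)
  obtain i where i: "i \<in> K" "s \<in> T i"
    using psubset.prems(1,3) by fastforce
  have "compact (T i \<inter> {s..t})"
    using psubset.prems(2)[OF i(1)] by (intro closed_Int_compact) auto
  moreover have "s \<in> T i \<inter> {s..t}"
    using i psubset.prems(1) by simp
  ultimately obtain r where "r \<in> T i \<inter> {s..t}" "\<forall>x\<in>T i \<inter> {s..t}. x \<le> r"
    using compact_attains_sup[of "T i \<inter> {s..t}"] by blast
  then have r: "r \<in> T i" "s \<le> r" "r \<le> t" "\<And>x. x \<in> T i \<Longrightarrow> s \<le> x \<Longrightarrow> x \<le> t \<Longrightarrow> x \<le> r"
    by auto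
  have first: "N (f s - f r) \<le> L * (r - s)"
    using psubset.prems(4)[OF i(1,2) r(1,2) order_refl r(3)] .
  show ?case
  proof (cases "r = t")
    case True
    then show ?thesis using first by simp
  next
    case False
    then have "r < t" using r(3) by simp
    have "x \<in> (\<Union>j\<in>K - {i}. T j)" if "x \<in> {r<..t}" for x
    proof -
      have "x \<in> {s..t}" using that r(2) by auto
      then obtain j where "j \<in> K" "x \<in> T j" using psubset.prems(3) by blast
      moreover have "x \<notin> T i" using r(2) r(4)[of x] that by auto
      ultimately show ?thesis by blast
    qed
    moreover have "closed (\<Union>j\<in>K - {i}. T j)"
      using psubset.hyps psubset.prems(2) by (intro closed_UN) auto
    \<comment> \<open>The other pieces are only known to cover the points beyond \<open>r\<close>;
      closedness adds \<open>r\<close> itself, where the next jump starts.\<close>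
    ultimately have "closure {r<..t} \<subseteq> (\<Union>j\<in>K - {i}. T j)"
      by (intro closure_minimal) auto
    then have cover: "{r..t} \<subseteq> (\<Union>j\<in>K - {i}. T j)"
      using \<open>r < t\<close> by (simp add: closure_greaterThanAtMost)
    have "N (f r - f t) \<le> L * (t - r)"
    proof (rule psubset.IH)
      show "K - {i} \<subset> K"
        using i(1) by blast
      show "N (f x - f y) \<le> L * (y - x)"
        if "j \<in> K - {i}" "x \<in> T j" "y \<in> T j" "x \<le> y" "r \<le> x" "y \<le> t" for j x y
        using psubset.prems(4)[of j x y] r(2) that by auto
      show "closed (T j)" if "j \<in> K - {i}" for j
        using psubset.prems(2) that by blast
    qed (fact r(3) cover)+
    moreover have "N (f s - f t) \<le> N (f s - f r) + N (f r - f t)"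
    proof -
      have "f s - f t = (f s - f r) + (f r - f t)" by simp
      then show ?thesis
        using assms(1) unfolding is_norm_def by metis
    qed
    ultimately show ?thesis
      using first by (simp add: algebra_simps)
  qed
qed

section \<open>Kernel vectors and lower bounds\<close>

text \<open>The KKT system has \<open>- c\<close> on its right-hand side, whereas distances are
  measured in \<open>c\<close>.\<close>

lemma param_norm_uminus_fst:
  assumes "is_norm N"
  shows "param_norm N (- \<alpha>, \<beta>) = param_norm N (\<alpha>, \<beta>)"
  using dual_norm_scaleR[OF assms, of "- 1" \<alpha>] by (simp add: param_norm_def)

lemma open_contains_line:
  fixes V :: "'a::real_normed_vector set"
  assumes "open V" "p \<in> V"
  obtains e where "0 < e" "\<And>s. \<bar>s\<bar> \<le> e \<Longrightarrow> p + s *\<^sub>R q \<in> V"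
proof -
  have "((\<lambda>s. p + s *\<^sub>R q) \<longlongrightarrow> p + 0 *\<^sub>R q) (at 0)"
    by (intro tendsto_intros)
  then have "\<forall>\<^sub>F s in at 0. p + s *\<^sub>R q \<in> V"
    using assms by (intro topological_tendstoD) auto
  then obtain d where d: "0 < d" "\<And>s. s \<noteq> 0 \<Longrightarrow> \<bar>s\<bar> < d \<Longrightarrow> p + s *\<^sub>R q \<in> V"
    unfolding eventually_at by (auto simp: dist_real_def)
  show thesis
  proof
    show "p + s *\<^sub>R q \<in> V" if "\<bar>s\<bar> \<le> d / 2" for s
      using d that assms(2) by (cases "s = 0") auto
  qed (use d in simp)
qed

section \<open>Minimal and independent KKT sets\<close>

lemma minimal_kkt_set_coeffs:
  fixes a :: "'m::finite \<Rightarrow> real^'n"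
  assumes "D \<in> minimal_kkt_sets Q a c b x"
  obtains l where "- (Q *v x + c) = (\<Sum>i\<in>D. l i *\<^sub>R a i)" "\<And>i. i \<in> D \<Longrightarrow> 0 < l i"
    "independent_family a D"
proof (rule minimal_cone_coeffs)
  show "- (Q *v x + c) \<in> convex_cone hull (a ` D)"
    "\<And>D'. D' \<subset> D \<Longrightarrow> - (Q *v x + c) \<notin> convex_cone hull (a ` D')"
    using assms by (auto simp: minimal_kkt_sets_def kkt_set_def)
qed (use that in auto)

lemma independent_kkt_sets_iff:
  fixes a :: "'m::finite \<Rightarrow> real^'n"
  shows "D \<in> independent_kkt_sets Q a c b x \<longleftrightarrow>
    D \<subseteq> active a b x \<and> independent_family a D \<and> kkt_set Q a c x D"
  by (auto simp: independent_kkt_sets_def independent_family_iff)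

lemma minimal_kkt_sets_subset:
  fixes a :: "'m::finite \<Rightarrow> real^'n"
  shows "minimal_kkt_sets Q a c b x \<subseteq> independent_kkt_sets Q a c b x"
proof
  fix D assume D: "D \<in> minimal_kkt_sets Q a c b x"
  then have "independent_family a D"
    using minimal_kkt_set_coeffs by metis
  then show "D \<in> independent_kkt_sets Q a c b x"
    using D by (simp add: independent_kkt_sets_iff minimal_kkt_sets_def)
qed

lemma minimal_kkt_set_exists:
  fixes a :: "'m::finite \<Rightarrow> real^'n"
  assumes "E \<subseteq> active a b x" "kkt_set Q a c x E"
  obtains D where "D \<subseteq> E" "D \<in> minimal_kkt_sets Q a c b x"
proof -
  obtain D where "D \<subseteq> E" "kkt_set Q a c x D" "\<And>D'. D' \<subset> D \<Longrightarrow> \<not> kkt_set Q a c x D'"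
    using finite_minimal_subset[of E "kkt_set Q a c x"] assms(2) by (metis finite)
  then show thesis
    using that assms(1) by (simp add: minimal_kkt_sets_def subset_trans)
qed

lemma argmin_minimal_kkt_set:
  fixes Q :: "real^'n^'n" and a :: "'m::finite \<Rightarrow> real^'n"
  assumes "transpose Q = Q" "x \<in> qp_argmin Q a (c, b)"
  obtains D where "D \<in> minimal_kkt_sets Q a c b x"
  using minimal_kkt_set_exists[OF subset_refl kkt_necessary[OF assms]] by metis

lemma nonsingular_minimal_imp_independent:
  fixes Q :: "real^'n^'n" and a :: "'m::finite \<Rightarrow> real^'n"
  assumes "transpose Q = Q" "pos_semidef Q"
    and min: "\<forall>D\<in>minimal_kkt_sets Q a c b x. nonsingular_on (UNIV <+> D) (kkt_matrix Q a)"
    and D: "D \<in> independent_kkt_sets Q a c b x"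
  shows "nonsingular_on (UNIV <+> D) (kkt_matrix Q a)"
proof -
  obtain D0 where D0: "D0 \<subseteq> D" "D0 \<in> minimal_kkt_sets Q a c b x"
    using minimal_kkt_set_exists D unfolding independent_kkt_sets_iff by metis
  have indep: "independent_family a D0" "independent_family a D"
    using D minimal_kkt_sets_subset[THEN subsetD, OF D0(2)]
    by (simp_all add: independent_kkt_sets_iff)
  have "\<forall>x. Q *v x = 0 \<and> (\<forall>i\<in>D0. a i \<bullet> x = 0) \<longrightarrow> x = 0"
    using min D0(2) nonsingular_kkt_iff_independent[OF assms(1,2) indep(1)] by blast
  then show ?thesis
    using D0(1) unfolding nonsingular_kkt_iff_independent[OF assms(1,2) indep(2)] by blast
qed

section \<open>Consequences of the Aubin property\<close>

text \<open>However small the tilt \<open>\<epsilon>\<close>, every minimizer of the tilted problem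
  lies at least as far in direction \<open>- u\<close> as the end
  \<open>x - \<sigma> *\<^sub>R u\<close> of the segment. So \<open>x\<close> keeps a distance
  \<open>\<delta>\<close> to them that does not depend on \<open>\<epsilon>\<close>, while the Aubin
  estimate allows at most \<open>\<kappa> * P * \<epsilon>\<close>.\<close>

lemma aubin_imp_nonsingular:
  fixes Q :: "real^'n^'n" and a :: "'m::finite \<Rightarrow> real^'n"
  assumes N: "is_norm N" and Q: "transpose Q = Q" "pos_semidef Q"
    and x: "x \<in> feasible a b"
    and D: "D \<in> independent_kkt_sets Q a c b x"
    and aubin: "aubin_constant N (qp_argmin Q a) (c, b) x \<kappa>"
  shows "nonsingular_on (UNIV <+> D) (kkt_matrix Q a)"
proof (rule ccontr)
  assume sing: "\<not> nonsingular_on (UNIV <+> D) (kkt_matrix Q a)"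
  have D': "D \<subseteq> active a b x" "independent_family a D" "kkt_set Q a c x D"
    using D by (simp_all add: independent_kkt_sets_iff)
  \<comment> \<open>Independence of \<open>D\<close> forces a kernel vector with nonzero top
    block.\<close>
  obtain u where u: "u \<noteq> 0" "Q *v u = 0" "\<And>i. i \<in> D \<Longrightarrow> a i \<bullet> u = 0"
    using sing nonsingular_kkt_iff_independent[OF Q D'(2)] by blast
  obtain U V where "0 \<le> \<kappa>" "x \<in> U" and V: "open V" "(c, b) \<in> V"
    and lip: "\<And>p1 p2 x2. p1 \<in> V \<Longrightarrow> p2 \<in> V \<Longrightarrow> x2 \<in> qp_argmin Q a p2 \<inter> U \<Longrightarrow>
      dist_to_set N x2 (qp_argmin Q a p1) \<le> ereal (\<kappa> * param_norm N (p2 - p1))"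
    using aubin unfolding aubin_constant_def by metis
  define w :: "real^'m" where "w = (\<chi> i. if i \<in> D then 0 else 1)"
  obtain t where t: "0 < t" "(c, b) + t *\<^sub>R (0, w) \<in> V"
    using open_contains_line[OF V, of "(0, w)"] by (metis abs_of_pos order_refl)
  define b' where "b' = b + t *\<^sub>R w"
  have b': "b' $ i = (if i \<in> D then b $ i else b $ i + t)" for i
    by (simp add: b'_def w_def)
  have V': "(c, b') \<in> V"
    using t(2) by (simp add: b'_def)
  \<comment> \<open>For \<open>\<bar>s\<bar> \<le> \<sigma>\<close> no constraint outside
    \<open>D\<close> can use up the additional slack \<open>t\<close>.\<close>
  define \<sigma> where "\<sigma> = t / ((\<Sum>i\<in>UNIV. \<bar>a i \<bullet> u\<bar>) + 1)"
  have sum_pos: "0 < (\<Sum>i\<in>UNIV. \<bar>a i \<bullet> u\<bar>) + 1"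
    by (intro add_nonneg_pos sum_nonneg) auto
  then have \<sigma>: "0 < \<sigma>" "\<sigma> * ((\<Sum>i\<in>UNIV. \<bar>a i \<bullet> u\<bar>) + 1) = t"
    using t(1) by (simp_all add: \<sigma>_def)
  \<comment> \<open>relaxing the constraints outside \<open>D\<close> makes the argmin contain a segment in direction \<open>u\<close>\<close>
  have argmin: "x + s *\<^sub>R u \<in> qp_argmin Q a (c, b')" if "\<bar>s\<bar> \<le> \<sigma>" for s
  proof (rule kkt_sufficient[OF Q])
    show "kkt_set Q a c (x + s *\<^sub>R u) D"
      using D'(3) u(2) by (simp add: kkt_set_def matrix_vector_right_distrib matrix_vector_mult_scaleR)
    show "D \<subseteq> active a b' (x + s *\<^sub>R u)"
      using D'(1) u(3) by (auto simp: active_def b' inner_add_right)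
    have "a i \<bullet> (x + s *\<^sub>R u) \<le> b' $ i" for i
    proof (cases "i \<in> D")
      case True
      then show ?thesis using x u(3) by (simp add: feasible_def b' inner_add_right)
    next
      case False
      have "\<bar>s * (a i \<bullet> u)\<bar> \<le> \<sigma> * ((\<Sum>i\<in>UNIV. \<bar>a i \<bullet> u\<bar>) + 1)"
        unfolding abs_mult using that \<sigma>(1) member_le_sum[of i UNIV "\<lambda>i. \<bar>a i \<bullet> u\<bar>"]
        by (intro mult_mono) auto
      moreover have "a i \<bullet> x \<le> b $ i" using x by (simp add: feasible_def)
      ultimately show ?thesis using False \<sigma>(2) by (simp add: b' inner_add_right)
    qed
    then show "x + s *\<^sub>R u \<in> feasible a b'" by (simp add: feasible_def)
  qed
  obtain e where e: "0 < e" "\<And>x. e * norm x \<le> N x"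
    using is_norm_bounds[OF N] by metis
  define \<delta> where "\<delta> = e * (\<sigma> * norm u)"
  have \<delta>: "0 < \<delta>"
    using e(1) \<sigma>(1) u(1) by (simp add: \<delta>_def)
  \<comment> \<open>Adding the two optimality inequalities cancels the untilted objective and
    compares \<open>x1\<close> with the end \<open>x2\<close> of the segment along \<open>u\<close>
    alone.\<close>
  have far: "\<delta> \<le> N (x - x1)" if "x1 \<in> qp_argmin Q a (c + \<epsilon> *\<^sub>R u, b')" "0 < \<epsilon>" for x1 \<epsilon>
  proof -
    define x2 where "x2 = x + (- \<sigma>) *\<^sub>R u"
    have "x2 \<in> qp_argmin Q a (c, b')"
      unfolding x2_def using \<sigma>(1) by (intro argmin) simp
    then have "qp_objective Q c x2 \<le> qp_objective Q c x1"
      "qp_objective Q (c + \<epsilon> *\<^sub>R u) x1 \<le> qp_objective Q (c + \<epsilon> *\<^sub>R u) x2"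
      using that(1) by (simp_all add: qp_argmin_iff)
    then have "\<epsilon> * (u \<bullet> x1) \<le> \<epsilon> * (u \<bullet> x2)"
      by (simp add: qp_objective_def inner_add_left)
    then have "u \<bullet> x1 \<le> u \<bullet> x2"
      using that(2) by simp
    then have "norm u * (\<sigma> * norm u) \<le> u \<bullet> (x - x1)"
      by (simp add: x2_def inner_diff_right inner_add_right dot_square_norm power2_eq_square mult.left_commute)
    also have "\<dots> \<le> norm u * norm (x - x1)"
      by (rule norm_cauchy_schwarz)
    finally have "\<sigma> * norm u \<le> norm (x - x1)"
      using u(1) by simp
    then have "\<delta> \<le> e * norm (x - x1)"
      unfolding \<delta>_def using e(1) by (intro mult_left_mono) auto
    then show ?thesis using e(2) order_trans by blast
  qed
  define P where "P = param_norm N (u, 0 :: real^'m)"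
  have P: "0 \<le> \<kappa> * P"
    using \<open>0 \<le> \<kappa>\<close> param_norm_nonneg[OF N, of "(u, 0 :: real^'m)"] by (simp add: P_def)
  have bound: "\<delta> \<le> \<kappa> * P * \<epsilon>" if "0 < \<epsilon>" "(c + \<epsilon> *\<^sub>R u, b') \<in> V" for \<epsilon>
  proof -
    have "x \<in> qp_argmin Q a (c, b') \<inter> U"
      using argmin[of 0] \<sigma>(1) \<open>x \<in> U\<close> by simp
    from lip[OF that(2) V' this]
    have "dist_to_set N x (qp_argmin Q a (c + \<epsilon> *\<^sub>R u, b'))
      \<le> ereal (\<kappa> * param_norm N ((- \<epsilon>) *\<^sub>R (u, 0 :: real^'m)))"
      by simp
    \<comment> \<open>If the tilted problem has no minimizer, the infimum is
      \<open>\<infinity>\<close> and the bound holds as well.\<close>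
    moreover have "ereal \<delta> \<le> dist_to_set N x (qp_argmin Q a (c + \<epsilon> *\<^sub>R u, b'))"
      unfolding dist_to_set_def using far that(1) by (intro INF_greatest) simp
    ultimately have "ereal \<delta> \<le> ereal (\<kappa> * param_norm N ((- \<epsilon>) *\<^sub>R (u, 0 :: real^'m)))"
      using order_trans by blast
    then show ?thesis
      unfolding param_norm_scaleR[OF N] P_def[symmetric] using that(1) by (simp add: ac_simps)
  qed
  obtain d where d: "0 < d" "\<And>s. \<bar>s\<bar> \<le> d \<Longrightarrow> (c, b') + s *\<^sub>R (u, 0) \<in> V"
    using open_contains_line[OF V(1) V', of "(u, 0)"] by metis
  \<comment> \<open>Chosen so that the allowed distance \<open>\<kappa> * P * \<epsilon>\<close> is
    at most \<open>\<delta> / 2\<close>; adding 1 covers \<open>\<kappa> * P = 0\<close>.\<close>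
  define \<epsilon> where "\<epsilon> = min d (\<delta> / (2 * (\<kappa> * P + 1)))"
  have \<epsilon>: "0 < \<epsilon>" "\<epsilon> \<le> d" "\<epsilon> \<le> \<delta> / (2 * (\<kappa> * P + 1))"
    using d(1) \<delta> P by (simp_all add: \<epsilon>_def)
  have "\<delta> \<le> \<kappa> * P * \<epsilon>"
    using d(2)[of \<epsilon>] \<epsilon> by (intro bound) auto
  also have "\<dots> \<le> (\<kappa> * P + 1) * (\<delta> / (2 * (\<kappa> * P + 1)))"
    using \<epsilon> P by (intro mult_mono) auto
  also have "\<dots> = \<delta> / 2"
    using P by (simp add: field_simps)
  finally show False using \<delta> by simp
qed

text \<open>Under strict complementarity the solution in direction
  \<open>(- \<alpha>, \<beta>)\<close> is, for small positive \<open>s\<close>, exactly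
  \<open>x + s *\<^sub>R u\<close> with \<open>u\<close> the image of
  \<open>(\<alpha>, \<beta>)\<close>. For a unit direction the quotient of displacements is
  therefore \<open>N u\<close>, and the Aubin constant must dominate it.\<close>

lemma aubin_constant_ge_kkt_inverse_norm:
  fixes Q :: "real^'n^'n" and a :: "'m::finite \<Rightarrow> real^'n"
  assumes N: "is_norm N" and Q: "transpose Q = Q" "pos_semidef Q"
    and x: "x \<in> feasible a b"
    and D: "D \<in> independent_kkt_sets Q a c b x"
    and nonsing: "nonsingular_on (UNIV <+> D) (kkt_matrix Q a)"
    and aubin: "aubin_constant N (qp_argmin Q a) (c, b) x \<kappa>"
  shows "kkt_inverse_norm N Q a D \<le> \<kappa>"
proof -
  obtain U V where "0 \<le> \<kappa>" "x \<in> U" and V: "open V" "(c, b) \<in> V"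
    and lip: "\<And>p1 p2 x2. p1 \<in> V \<Longrightarrow> p2 \<in> V \<Longrightarrow> x2 \<in> qp_argmin Q a p2 \<inter> U \<Longrightarrow>
      dist_to_set N x2 (qp_argmin Q a p1) \<le> ereal (\<kappa> * param_norm N (p2 - p1))"
    using aubin unfolding aubin_constant_def by metis
  have act: "D \<subseteq> active a b x" and kkt: "kkt_set Q a c x D"
    using D by (simp_all add: independent_kkt_sets_iff)
  obtain l where l: "\<forall>i\<in>D. 0 \<le> l i" "- (Q *v x + c) = (\<Sum>i\<in>D. l i *\<^sub>R a i)"
    using kkt unfolding kkt_set_def by (subst (asm) convex_cone_hull_image_iff) auto
  \<comment> \<open>a nearby parameter at which \<open>x\<close> is still optimal, with strict complementarity on \<open>D\<close>\<close>
  define w :: "real^'m" where "w = (\<chi> i. if i \<in> D then 0 else 1)"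
  define v where "v = - (\<Sum>i\<in>D. a i)"
  obtain t where t: "0 < t" "(c, b) + t *\<^sub>R (v, w) \<in> V"
    using open_contains_line[OF V, of "(v, w)"] by (metis abs_of_pos order_refl)
  define b' where "b' = b + t *\<^sub>R w"
  define c' where "c' = c + t *\<^sub>R v"
  have b': "b' $ i = (if i \<in> D then b $ i else b $ i + t)" for i
    by (simp add: b'_def w_def)
  have l': "- (Q *v x + c') = (\<Sum>i\<in>D. (l i + t) *\<^sub>R a i)"
  proof -
    have "(\<Sum>i\<in>D. (l i + t) *\<^sub>R a i) = - (Q *v x + c) - t *\<^sub>R v"
      unfolding l(2) by (simp add: v_def scaleR_add_left sum.distrib scaleR_sum_right)
    then show ?thesis by (simp add: c'_def)
  qed
  have V': "(c', b') \<in> V"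
    using t(2) by (simp add: b'_def c'_def)
  have "x \<in> qp_argmin Q a (c', b')"
  proof (rule kkt_sufficient[OF Q])
    show "kkt_set Q a c' x D"
      unfolding kkt_set_def l' using l(1) t(1)
      by (subst convex_cone_hull_image_iff) (auto intro!: exI[of _ "\<lambda>i. l i + t"])
    show "D \<subseteq> active a b' x"
      using act by (auto simp: active_def b')
    show "x \<in> feasible a b'"
      using x t(1) by (auto simp: feasible_def b' intro: add_increasing2)
  qed
  have unit_bound: "N (kkt_inverse_top Q a D \<alpha> \<beta>) \<le> \<kappa>"
    if \<beta>: "\<forall>i. i \<notin> D \<longrightarrow> \<beta> $ i = 0" and unit: "max (dual_norm N \<alpha>) (infnorm \<beta>) = 1" for \<alpha> \<beta>
  proof -
    define u where "u = kkt_inverse_top Q a D \<alpha> \<beta>"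
    obtain m where m: "Q *v u + (\<Sum>i\<in>D. m i *\<^sub>R a i) = \<alpha>" "\<And>i. i \<in> D \<Longrightarrow> a i \<bullet> u = \<beta> $ i"
      using kkt_inverse_top_solves[OF nonsing] unfolding u_def by metis
    obtain d where d: "0 < d" "\<And>s. \<bar>s\<bar> \<le> d \<Longrightarrow> (c', b') + s *\<^sub>R (- \<alpha>, \<beta>) \<in> V"
      using open_contains_line[OF V(1) V', of "(- \<alpha>, \<beta>)"] by metis
    \<comment> \<open>Bounds the rate of change of every constraint value and every multiplier along
      the direction; adding 1 makes the bound strict, so that the multipliers on \<open>D\<close>
      stay positive.\<close>
    define R where "R = (\<Sum>i\<in>UNIV. \<bar>a i \<bullet> u\<bar> + \<bar>m i\<bar>) + 1"
    have R: "\<bar>a i \<bullet> u\<bar> + \<bar>m i\<bar> < R" for i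
      using member_le_sum[of i UNIV "\<lambda>i. \<bar>a i \<bullet> u\<bar> + \<bar>m i\<bar>"] by (simp add: R_def)
    have R0: "0 < R"
      using R[of undefined] by linarith
    define s where "s = min d (t / R)"
    have s: "0 < s" "s \<le> d" "s * R \<le> t"
      using d(1) t(1) R0 by (simp_all add: s_def min_le_iff_disj flip: pos_le_divide_eq)
    have small: "s * (\<bar>a i \<bullet> u\<bar> + \<bar>m i\<bar>) < t" for i
      using R[of i] s(1,3) by (meson mult_strict_left_mono order_less_le_trans)
    have small_a: "s * (a i \<bullet> u) \<le> t" and small_m: "- t < s * m i" for i
    proof -
      have "s * \<bar>a i \<bullet> u\<bar> + s * \<bar>m i\<bar> < t"
        using small[of i] by (simp add: distrib_left)
      moreover have "0 \<le> s * \<bar>a i \<bullet> u\<bar>" "0 \<le> s * \<bar>m i\<bar>" using s(1) by simp_all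
      moreover have "s * (a i \<bullet> u) \<le> s * \<bar>a i \<bullet> u\<bar>" "s * (- m i) \<le> s * \<bar>m i\<bar>"
        by (rule mult_left_mono; use s(1) in simp)+
      ultimately show "s * (a i \<bullet> u) \<le> t" "- t < s * m i" by auto
    qed
    define b1 where "b1 = b' + s *\<^sub>R \<beta>"
    define c1 where "c1 = c' - s *\<^sub>R \<alpha>"
    \<comment> \<open>The move by \<open>s *\<^sub>R (- \<alpha>, \<beta>)\<close> shifts the
      solution by \<open>s *\<^sub>R u\<close> and the multipliers by
      \<open>s * m i\<close>.\<close>
    define x1 where "x1 = x + s *\<^sub>R u"
    have p1: "(c', b') + s *\<^sub>R (- \<alpha>, \<beta>) = (c1, b1)"
      by (simp add: b1_def c1_def)
    have "qp_argmin Q a (c1, b1) = {x1}"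
    proof (rule kkt_unique[OF Q])
      have "a i \<bullet> x1 \<le> b1 $ i" for i
      proof (cases "i \<in> D")
        case True
        then show ?thesis
          using x m(2) by (simp add: feasible_def x1_def b1_def b' inner_add_right)
      next
        case False
        have "a i \<bullet> x \<le> b $ i" using x by (simp add: feasible_def)
        then show ?thesis
          using False \<beta> small_a[of i] by (simp add: x1_def b1_def b' inner_add_right)
      qed
      then show "x1 \<in> feasible a b1" by (simp add: feasible_def)
      show "D \<subseteq> active a b1 x1"
        using act m(2) by (auto simp: active_def x1_def b1_def b' inner_add_right)
      have "- (Q *v x1 + c1) = - (Q *v x + c') + s *\<^sub>R (\<Sum>i\<in>D. m i *\<^sub>R a i)"
        unfolding x1_def c1_def m(1)[symmetric]
        by (simp add: matrix_vector_right_distrib matrix_vector_mult_scaleR algebra_simps)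
      then show "- (Q *v x1 + c1) = (\<Sum>i\<in>D. (l i + t + s * m i) *\<^sub>R a i)"
        unfolding l' by (simp add: scaleR_add_left sum.distrib scaleR_sum_right)
      show "0 < l i + t + s * m i" if "i \<in> D" for i
        using l(1) that small_m[of i] by fastforce
    qed (fact nonsing)
    moreover have "(c1, b1) \<in> V"
      using d(2)[of s] s unfolding p1 by simp
    \<comment> \<open>The moved parameter supplies the target set: this is the singleton
      \<open>{x1}\<close>, so the distance from \<open>x\<close> is exactly
      \<open>N (x - x1)\<close>.\<close>
    ultimately have "dist_to_set N x {x1} \<le> ereal (\<kappa> * param_norm N ((c', b') - (c1, b1)))"
      using lip[OF _ V', of "(c1, b1)" x] \<open>x \<in> qp_argmin Q a (c', b')\<close> \<open>x \<in> U\<close> by simp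
    moreover have "(c', b') - (c1, b1) = (- s) *\<^sub>R (- \<alpha>, \<beta>)"
      by (simp flip: p1)
    moreover have "param_norm N (- \<alpha>, \<beta>) = 1"
      using unit unfolding param_norm_uminus_fst[OF N] by (simp add: param_norm_def)
    moreover have "N (x - x1) = s * N u"
    proof -
      have "x - x1 = (- s) *\<^sub>R u" by (simp add: x1_def)
      then show ?thesis using N s(1) by (metis abs_minus_cancel abs_of_pos is_norm_def)
    qed
    ultimately have "s * N u \<le> \<kappa> * s"
      using param_norm_scaleR[OF N, of "- s" "(- \<alpha>, \<beta>)"] s(1)
      by (simp add: dist_to_set_def)
    then show ?thesis
      using s(1) by (simp add: u_def mult.commute)
  qed
  obtain \<alpha> where "dual_norm N \<alpha> = 1"
    using dual_norm_unit_exists[OF N] .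
  then have nonempty: "(\<forall>i. i \<notin> D \<longrightarrow> (0 :: real^'m) $ i = 0) \<and> max (dual_norm N \<alpha>) (infnorm (0 :: real^'m)) = 1"
    by (simp add: infnorm_0)
  show ?thesis
    unfolding kkt_inverse_norm_def
  proof (rule cSup_least)
    show "{N (kkt_inverse_top Q a D \<alpha> \<beta>) |\<alpha> \<beta>.
      (\<forall>i. i \<notin> D \<longrightarrow> \<beta> $ i = 0) \<and> max (dual_norm N \<alpha>) (infnorm \<beta>) = 1} \<noteq> {}"
      using nonempty by blast
  qed (use unit_bound in auto)
qed

section \<open>Stability and upper bounds\<close>

text \<open>For fixed \<open>D\<close> activity is a system of equations, and the cone is closed and
  constant, so no multipliers have to be followed along a sequence.\<close>

lemma closed_kkt_graph:
  fixes Q :: "real^'n^'n" and a :: "'m::finite \<Rightarrow> real^'n"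
  shows "closed {(p, x). D \<subseteq> active a (snd p) x \<and> kkt_set Q a (fst p) x D}"
proof -
  have "closed (\<Inter>i\<in>D. {z. a i \<bullet> snd z = snd (fst z) $ i})"
    by (intro closed_INT ballI closed_Collect_eq continuous_intros)
  moreover have "closed ((\<lambda>z. - (Q *v snd z + fst (fst z))) -` (convex_cone hull (a ` D)))"
    by (intro continuous_closed_vimage closed_convex_cone_hull continuous_intros
        bounded_linear.continuous_on[OF matrix_vector_mul_bounded_linear]) auto
  ultimately have "closed ((\<Inter>i\<in>D. {z. a i \<bullet> snd z = snd (fst z) $ i}) \<inter>
      (\<lambda>z. - (Q *v snd z + fst (fst z))) -` (convex_cone hull (a ` D)))"
    by (rule closed_Int)
  then show ?thesis
    by (rule back_subst[of closed]) (auto simp: active_def kkt_set_def)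
qed

text \<open>Finitely many independent sets lie outside the reference family; each violates a closed
  condition at the reference point, hence in a neighbourhood of it. Independence itself does not
  change with the parameter.\<close>

lemma independent_kkt_sets_upper_semicontinuous:
  fixes Q :: "real^'n^'n" and a :: "'m::finite \<Rightarrow> real^'n"
  obtains V \<delta> where "open V" "(c, b) \<in> V" "0 < \<delta>"
    "\<And>p y. p \<in> V \<Longrightarrow> y \<in> ball x \<delta> \<Longrightarrow>
      independent_kkt_sets Q a (fst p) (snd p) y \<subseteq> independent_kkt_sets Q a c b x"
proof -
  define F where "F = {D. independent_family a D} - independent_kkt_sets Q a c b x"
  define W where
    "W = (\<Inter>D\<in>F. - {(p, y). D \<subseteq> active a (snd p) y \<and> kkt_set Q a (fst p) y D})"
  have "open W"
    unfolding W_def by (intro open_INT) (auto intro: closed_kkt_graph)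
  moreover have "((c, b), x) \<in> W"
    by (auto simp: W_def F_def independent_kkt_sets_iff)
  ultimately obtain V U where VU: "open V" "open U" "((c, b), x) \<in> V \<times> U" "V \<times> U \<subseteq> W"
    by (rule open_prod_elim)
  then obtain \<delta> where "0 < \<delta>" "ball x \<delta> \<subseteq> U"
    using open_contains_ball by (metis mem_Sigma_iff)
  show thesis
  proof
    show "open V" "(c, b) \<in> V" "0 < \<delta>"
      using VU \<open>0 < \<delta>\<close> by auto
    fix p y assume "p \<in> V" "y \<in> ball x \<delta>"
    then have "(p, y) \<in> W"
      using VU \<open>ball x \<delta> \<subseteq> U\<close> by blast
    then have "D \<in> independent_kkt_sets Q a c b x"
      if "independent_family a D" "D \<subseteq> active a (snd p) y" "kkt_set Q a (fst p) y D" for D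
      using that unfolding W_def F_def by blast
    then show "independent_kkt_sets Q a (fst p) (snd p) y \<subseteq> independent_kkt_sets Q a c b x"
      unfolding independent_kkt_sets_iff[of _ Q a "fst p"] subset_iff by blast
  qed
qed

lemma closed_feasible: "closed (feasible a b)"
  unfolding feasible_def by (intro closed_Collect_all closed_Collect_le continuous_intros)

text \<open>A minimizer over the closed ball exists by compactness. It is a global one because a
  competitor \<open>z\<close> inside the ball beats every feasible point on the sphere and hence, by
  convexity along segments from \<open>z\<close>, every feasible point outside.\<close>

lemma argmin_stable:
  fixes Q :: "real^'n^'n" and a :: "'m::finite \<Rightarrow> real^'n"
  assumes Q: "transpose Q = Q" "pos_semidef Q"
    and "slater a b" and uniq: "qp_argmin Q a (c, b) = {x}" and "0 < \<delta>"
  obtains V where "open V" "(c, b) \<in> V"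
    "\<And>p. p \<in> V \<Longrightarrow> qp_argmin Q a p \<noteq> {} \<and> qp_argmin Q a p \<subseteq> ball x \<delta>"
proof -
  obtain y where y: "\<And>i. a i \<bullet> y < b $ i"
    using \<open>slater a b\<close> unfolding slater_def by blast
  have x: "x \<in> feasible a b" "\<And>z. z \<in> feasible a b \<Longrightarrow> qp_objective Q c x \<le> qp_objective Q c z"
    using uniq by (metis insertI1 qp_argmin_iff)+
  have cont: "continuous_on A (qp_objective Q c')" for A c'
    by (intro continuous_intros)
  define K where "K = sphere x \<delta> \<inter> feasible a b"
  have "compact K"
    unfolding K_def by (intro compact_Int_closed compact_sphere closed_feasible)
  \<comment> \<open>Uniqueness makes the minimum over the feasible part of the sphere strictly
    larger than the value at \<open>x\<close>; if that part is empty, any larger number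
    serves.\<close>
  obtain M where M: "qp_objective Q c x < M" "\<And>w. w \<in> K \<Longrightarrow> M \<le> qp_objective Q c w"
  proof (cases "K = {}")
    case True
    then show thesis using that[of "qp_objective Q c x + 1"] by simp
  next
    case False
    then obtain w where w: "w \<in> K" "\<And>z. z \<in> K \<Longrightarrow> qp_objective Q c w \<le> qp_objective Q c z"
      using continuous_attains_inf[OF \<open>compact K\<close> _ cont[of K c]] by blast
    have "w \<noteq> x" "w \<in> feasible a b"
      using w(1) \<open>0 < \<delta>\<close> by (auto simp: K_def)
    then have "w \<notin> qp_argmin Q a (c, b)"
      using uniq by simp
    then have "qp_objective Q c x < qp_objective Q c w"
      using \<open>w \<in> feasible a b\<close> x(2) unfolding qp_argmin_iff by force
    then show thesis using that w(2) by blast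
  qed
  \<comment> \<open>a fixed strictly feasible point that remains a competitor for all nearby parameters\<close>
  have "open {z. qp_objective Q c z < M}"
    by (intro open_Collect_less continuous_intros)
  then have "open ({z. qp_objective Q c z < M} \<inter> ball x \<delta>)"
    by (rule open_Int) simp
  moreover have "x \<in> {z. qp_objective Q c z < M} \<inter> ball x \<delta>"
    using M(1) \<open>0 < \<delta>\<close> by simp
  ultimately obtain e where e: "0 < e"
    "\<And>s. \<bar>s\<bar> \<le> e \<Longrightarrow> x + s *\<^sub>R (y - x) \<in> {z. qp_objective Q c z < M} \<inter> ball x \<delta>"
    using open_contains_line[of _ x "y - x"] by metis
  define s where "s = min e 1"
  define z where "z = x + s *\<^sub>R (y - x)"
  have s: "0 < s" "s \<le> 1" "\<bar>s\<bar> \<le> e"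
    using e(1) by (auto simp: s_def)
  have z: "qp_objective Q c z < M" "z \<in> ball x \<delta>"
    using e(2)[OF s(3)] by (simp_all add: z_def)
  have slack: "a i \<bullet> z < b $ i" for i
  proof -
    have "a i \<bullet> z = (1 - s) * (a i \<bullet> x) + s * (a i \<bullet> y)"
      by (simp add: z_def inner_add_right inner_diff_right algebra_simps)
    also have "\<dots> < (1 - s) * b $ i + s * b $ i"
      using x(1) y s by (intro add_le_less_mono mult_left_mono mult_strict_left_mono) (auto simp: feasible_def)
    finally show ?thesis by (simp add: algebra_simps)
  qed
  \<comment> \<open>The set of bad pairs is closed, so its projection along the compact sphere, the
    set of bad parameters, is closed as well.\<close>
  define T where "T = {(w, p). w \<in> feasible a (snd p) \<and>
    qp_objective Q (fst p) w \<le> qp_objective Q (fst p) z}"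
  have "closed T"
  proof -
    have "closed {q. (\<forall>i. a i \<bullet> fst q \<le> snd (snd q) $ i) \<and>
        qp_objective Q (fst (snd q)) (fst q) \<le> qp_objective Q (fst (snd q)) z}"
      by (intro closed_Collect_conj closed_Collect_all closed_Collect_le continuous_intros)
    then show ?thesis
      by (rule back_subst[of closed]) (auto simp: T_def feasible_def)
  qed
  then have "closed {p. \<exists>w. w \<in> sphere x \<delta> \<and> (w, p) \<in> T}"
    by (intro closed_compact_projection compact_sphere)
  moreover have "open (\<Inter>i\<in>UNIV. {p :: (real^'n) \<times> (real^'m). a i \<bullet> z < snd p $ i})"
    by (intro open_INT ballI open_Collect_less continuous_intros) simp
  ultimately have open_V: "open ((\<Inter>i\<in>UNIV. {p. a i \<bullet> z < snd p $ i}) -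
      {p. \<exists>w. w \<in> sphere x \<delta> \<and> (w, p) \<in> T})"
    by (intro open_Diff)
  show thesis
  proof
    show "open ((\<Inter>i\<in>UNIV. {p. a i \<bullet> z < snd p $ i}) - {p. \<exists>w. w \<in> sphere x \<delta> \<and> (w, p) \<in> T})"
      by (fact open_V)
    show "(c, b) \<in> (\<Inter>i\<in>UNIV. {p. a i \<bullet> z < snd p $ i}) - {p. \<exists>w. w \<in> sphere x \<delta> \<and> (w, p) \<in> T}"
      using slack z(1) M(2) by (fastforce simp: T_def K_def)
    fix p assume p: "p \<in> (\<Inter>i\<in>UNIV. {p. a i \<bullet> z < snd p $ i}) - {p. \<exists>w. w \<in> sphere x \<delta> \<and> (w, p) \<in> T}"
    obtain c' b' where p_eq: "p = (c', b')" by (cases p)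
    have zf: "z \<in> feasible a b'"
      using p by (auto simp: p_eq feasible_def less_imp_le)
    have sphere: "qp_objective Q c' z < qp_objective Q c' w" if "w \<in> sphere x \<delta>" "w \<in> feasible a b'" for w
      using p that by (auto simp: p_eq T_def)
    have outside: "qp_objective Q c' z < qp_objective Q c' v" if v: "v \<in> feasible a b'" "v \<notin> ball x \<delta>" for v
    proof -
      \<comment> \<open>The distance from \<open>x\<close> is continuous along the segment from
        \<open>z\<close> in the ball to \<open>v\<close> outside, so the segment meets the
        sphere.\<close>
      have "\<exists>r\<ge>0. r \<le> 1 \<and> dist x ((1 - r) *\<^sub>R z + r *\<^sub>R v) = \<delta>"
        using z(2) v(2) by (intro IVT' continuous_intros) auto
      then obtain r where r: "0 \<le> r" "r \<le> 1" "dist x ((1 - r) *\<^sub>R z + r *\<^sub>R v) = \<delta>" by blast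
      define w where "w = (1 - r) *\<^sub>R z + r *\<^sub>R v"
      have "w \<in> feasible a b'"
      proof -
        have "a i \<bullet> w \<le> b' $ i" for i
        proof -
          have "a i \<bullet> w \<le> (1 - r) * b' $ i + r * b' $ i"
            using zf v(1) r unfolding w_def inner_add_right inner_scaleR_right
            by (intro add_mono mult_left_mono) (auto simp: feasible_def)
          then show ?thesis by (simp add: algebra_simps)
        qed
        then show ?thesis by (simp add: feasible_def)
      qed
      then have "qp_objective Q c' z < qp_objective Q c' w"
        using r(3) by (intro sphere) (simp_all add: w_def)
      also have "\<dots> \<le> (1 - r) * qp_objective Q c' z + r * qp_objective Q c' v"
        unfolding w_def by (rule qp_objective_convex[OF Q r(1,2)])
      finally have "0 < r * (qp_objective Q c' v - qp_objective Q c' z)"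
        by (simp add: algebra_simps)
      then show ?thesis
        using r(1) by (simp add: zero_less_mult_iff)
    qed
    have "compact (cball x \<delta> \<inter> feasible a b')" "z \<in> cball x \<delta> \<inter> feasible a b'"
      using z(2) zf by (auto intro: closed_feasible)
    then obtain v where v: "v \<in> cball x \<delta> \<inter> feasible a b'"
      "\<And>w. w \<in> cball x \<delta> \<inter> feasible a b' \<Longrightarrow> qp_objective Q c' v \<le> qp_objective Q c' w"
      using continuous_attains_inf[OF _ _ cont[of "cball x \<delta> \<inter> feasible a b'" c']] by blast
    have "v \<in> qp_argmin Q a (c', b')"
      unfolding qp_argmin_iff
    proof (intro conjI ballI)
      show "v \<in> feasible a b'" using v(1) by simp
      fix w assume w: "w \<in> feasible a b'"
      show "qp_objective Q c' v \<le> qp_objective Q c' w"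
      proof (cases "w \<in> ball x \<delta>")
        case True
        then show ?thesis using w v(2) by simp
      next
        case False
        then show ?thesis
          using outside[OF w] v(2)[OF \<open>z \<in> cball x \<delta> \<inter> feasible a b'\<close>] by simp
      qed
    qed
    moreover have "w \<in> ball x \<delta>" if "w \<in> qp_argmin Q a (c', b')" for w
      using outside[of w] that zf unfolding qp_argmin_iff by force
    ultimately show "qp_argmin Q a p \<noteq> {} \<and> qp_argmin Q a p \<subseteq> ball x \<delta>"
      unfolding p_eq by blast
  qed
qed

text \<open>The parameters are taken from a ball because its convexity keeps the connecting segments
  inside, where the finitely many linear maps \<open>G D\<close> describe the solution.\<close>

lemma kkt_inverse_norm_aubin_constant:
  fixes Q :: "real^'n^'n" and a :: "'m::finite \<Rightarrow> real^'n"
  assumes N: "is_norm N" and Q: "transpose Q = Q" "pos_semidef Q"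
    and slater: "slater a b" and uniq: "qp_argmin Q a (c, b) = {x}"
    and nonsing: "\<forall>D\<in>independent_kkt_sets Q a c b x. nonsingular_on (UNIV <+> D) (kkt_matrix Q a)"
    and \<kappa>: "0 \<le> \<kappa>" "\<And>D. D \<in> independent_kkt_sets Q a c b x \<Longrightarrow> kkt_inverse_norm N Q a D \<le> \<kappa>"
  shows "aubin_constant N (qp_argmin Q a) (c, b) x \<kappa>"
proof -
  define L where "L = independent_kkt_sets Q a c b x"
  obtain V1 \<delta> where V1: "open V1" "(c, b) \<in> V1" and "0 < \<delta>"
    and near: "\<And>p y. p \<in> V1 \<Longrightarrow> y \<in> ball x \<delta> \<Longrightarrow> independent_kkt_sets Q a (fst p) (snd p) y \<subseteq> L"
    unfolding L_def by (rule independent_kkt_sets_upper_semicontinuous[of c b x Q a]) blast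
  obtain V2 where V2: "open V2" "(c, b) \<in> V2"
    and stable: "\<And>p. p \<in> V2 \<Longrightarrow> qp_argmin Q a p \<noteq> {} \<and> qp_argmin Q a p \<subseteq> ball x \<delta>"
    using argmin_stable[OF Q slater uniq \<open>0 < \<delta>\<close>] by metis
  have "open (V1 \<inter> V2)" "(c, b) \<in> V1 \<inter> V2"
    using V1 V2 by auto
  then obtain r where r: "0 < r" "ball (c, b) r \<subseteq> V1 \<inter> V2"
    by (meson open_contains_ball)
  \<comment> \<open>The sign comes from the top KKT equation
    \<open>Q *v x + (\<Sum>i\<in>D. l i *\<^sub>R a i) = - c\<close>.\<close>
  define G where "G D p = kkt_inverse_top Q a D (- fst p) (snd p)" for D p
  have lin_G: "linear (G D)" for D
  proof -
    have "linear (\<lambda>p :: (real^'n) \<times> (real^'m). (- fst p, snd p))"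
      by (rule linearI) auto
    from linear_compose[OF this linear_kkt_inverse_top[of Q a D]] show ?thesis
      by (simp add: G_def[abs_def] o_def)
  qed
  have G_bound: "N (G D p) \<le> \<kappa> * param_norm N p" if "D \<in> L" for D p
  proof -
    have "N (G D p) \<le> kkt_inverse_norm N Q a D * param_norm N p"
      using kkt_inverse_norm_bound[OF N, of Q a D "- fst p" "snd p"]
        param_norm_uminus_fst[OF N, of "fst p" "snd p"] by (simp add: G_def)
    also have "\<dots> \<le> \<kappa> * param_norm N p"
      using \<kappa>(2) that param_norm_nonneg[OF N, of p] by (intro mult_right_mono) (auto simp: L_def)
    finally show ?thesis .
  qed
  \<comment> \<open>Formulated through the candidate \<open>G D p\<close> and the KKT conditions
    instead of the solution, so that closedness along segments follows from that of the KKT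
    graph.\<close>
  define piece where "piece D = {p. G D p \<in> feasible a (snd p) \<and> D \<subseteq> active a (snd p) (G D p) \<and>
    kkt_set Q a (fst p) (G D p) D}" for D
  have piece_argmin: "G D p \<in> qp_argmin Q a p" if "p \<in> piece D" for D p
    using that kkt_sufficient[OF Q, of "G D p" a "snd p" D "fst p"] by (simp add: piece_def)
  \<comment> \<open>Semicontinuity places a minimal set at the solution in \<open>L\<close>, so its
    matrix is nonsingular; its multipliers are positive, so the solution is unique. It equals
    \<open>G D p\<close> since it solves the same linear system.\<close>
  have local: "(\<exists>y. qp_argmin Q a p = {y}) \<and> (\<exists>D\<in>L. p \<in> piece D)" if "p \<in> ball (c, b) r" for p
  proof -
    have p: "p \<in> V1" "p \<in> V2" using that r(2) by auto
    obtain y where y: "y \<in> qp_argmin Q a (fst p, snd p)" "y \<in> ball x \<delta>"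
      using stable[OF p(2)] unfolding prod.collapse by blast
    then have feas: "y \<in> feasible a (snd p)"
      unfolding qp_argmin_iff by blast
    obtain D where D: "D \<in> minimal_kkt_sets Q a (fst p) (snd p) y"
      using argmin_minimal_kkt_set[OF Q(1) y(1)] .
    then have "D \<in> L"
      using minimal_kkt_sets_subset near[OF p(1) y(2)] by blast
    then have ns: "nonsingular_on (UNIV <+> D) (kkt_matrix Q a)"
      using nonsing by (simp add: L_def)
    obtain l where l: "- (Q *v y + fst p) = (\<Sum>i\<in>D. l i *\<^sub>R a i)" "\<And>i. i \<in> D \<Longrightarrow> 0 < l i"
      using minimal_kkt_set_coeffs[OF D] by metis
    have D': "D \<subseteq> active a (snd p) y" "kkt_set Q a (fst p) y D"
      using D by (simp_all add: minimal_kkt_sets_def)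
    have "Q *v y + (\<Sum>i\<in>D. l i *\<^sub>R a i) = - fst p"
      unfolding l(1)[symmetric] by simp
    moreover have "a i \<bullet> y = snd p $ i" if "i \<in> D" for i
      using D'(1) that by (auto simp: active_def)
    ultimately have "G D p = y"
      unfolding G_def by (rule kkt_inverse_top_eqI[OF ns])
    then have "p \<in> piece D"
      using D' feas by (simp add: piece_def)
    moreover have "qp_argmin Q a (fst p, snd p) = {y}"
      using kkt_unique[OF Q feas D'(1) l ns] .
    ultimately show ?thesis
      using \<open>D \<in> L\<close> by auto
  qed
  have "dist_to_set N x2 (qp_argmin Q a p1) \<le> ereal (\<kappa> * param_norm N (p2 - p1))"
    if p: "p1 \<in> ball (c, b) r" "p2 \<in> ball (c, b) r" and x2: "x2 \<in> qp_argmin Q a p2" for p1 p2 x2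
  proof -
    define seg where "seg t = p2 + t *\<^sub>R (p1 - p2)" for t :: real
    have seg: "seg t \<in> ball (c, b) r" if "0 \<le> t" "t \<le> 1" for t
    proof -
      have "seg t = (1 - t) *\<^sub>R p2 + t *\<^sub>R p1"
        by (simp add: seg_def algebra_simps)
      then show ?thesis
        using convex_ball[of "(c, b)" r] p that unfolding convex_alt by metis
    qed
    define f where "f t = (THE y. y \<in> qp_argmin Q a (seg t))" for t
    have f: "qp_argmin Q a (seg t) = {f t}" if "0 \<le> t" "t \<le> 1" for t
      using local[OF seg[OF that]] by (auto simp: f_def)
    \<comment> \<open>Affine in \<open>t\<close>: differences of values on one piece are multiples
      of \<open>G D (p1 - p2)\<close>, which \<open>G_bound\<close> controls.\<close>
    have G_seg: "G D (seg t) = G D p2 + t *\<^sub>R G D (p1 - p2)" for D t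
      by (simp only: seg_def linear_add[OF lin_G] linear_cmul[OF lin_G])
    have cont_G: "continuous_on UNIV (\<lambda>t. G D (seg t))" for D
      unfolding G_seg by (intro continuous_intros)
    have "N (f 0 - f 1) \<le> (\<kappa> * param_norm N (p1 - p2)) * (1 - 0)"
    proof (rule closed_cover_lipschitz[OF N, where K = L and T = "\<lambda>D. seg -` piece D"])
      show "finite L" by simp
      show "closed (seg -` piece D)" for D
      proof -
        have cont: "continuous_on UNIV (\<lambda>t. (seg t, G D (seg t)))"
          by (intro continuous_intros cont_G) (simp add: seg_def continuous_intros)
        have "closed ((\<lambda>t. (seg t, G D (seg t))) -`
            {(p, x). D \<subseteq> active a (snd p) x \<and> kkt_set Q a (fst p) x D})"
          using closed_kkt_graph cont by (rule closed_vimage)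
        moreover have "closed {t. \<forall>i. a i \<bullet> G D (seg t) \<le> snd (seg t) $ i}"
          by (intro closed_Collect_all closed_Collect_le continuous_intros cont_G)
            (simp add: seg_def, intro continuous_intros)
        ultimately have "closed ((\<lambda>t. (seg t, G D (seg t))) -`
            {(p, x). D \<subseteq> active a (snd p) x \<and> kkt_set Q a (fst p) x D} \<inter>
            {t. \<forall>i. a i \<bullet> G D (seg t) \<le> snd (seg t) $ i})"
          by (rule closed_Int)
        then show ?thesis
          by (rule back_subst[of closed]) (auto simp: piece_def feasible_def)
      qed
      show "{0..1} \<subseteq> (\<Union>D\<in>L. seg -` piece D)"
        using local[OF seg] by auto
      show "N (f s - f t) \<le> \<kappa> * param_norm N (p1 - p2) * (t - s)"
        if "D \<in> L" "s \<in> seg -` piece D" "t \<in> seg -` piece D" "s \<le> t" "0 \<le> s" "t \<le> 1" for D s t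
      proof -
        have "f s = G D (seg s)"
          using piece_argmin[of "seg s" D] f[of s] that by simp
        moreover have "f t = G D (seg t)"
          using piece_argmin[of "seg t" D] f[of t] that by simp
        ultimately have "f s - f t = (s - t) *\<^sub>R G D (p1 - p2)"
          by (simp add: G_seg scaleR_left_diff_distrib)
        then have "N (f s - f t) = \<bar>s - t\<bar> * N (G D (p1 - p2))"
          using N unfolding is_norm_def by metis
        also have "\<dots> \<le> (t - s) * (\<kappa> * param_norm N (p1 - p2))"
          using G_bound[OF that(1), of "p1 - p2"] that(4) by (intro mult_mono) (auto simp: N[unfolded is_norm_def])
        finally show ?thesis by (simp add: mult.commute)
      qed
    qed simp
    moreover have "x2 = f 0" "qp_argmin Q a p1 = {f 1}"
      using f[of 0] f[of 1] x2 by (simp_all add: seg_def)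
    moreover have "param_norm N (p2 - p1) = param_norm N (p1 - p2)"
      using param_norm_scaleR[OF N, of "- 1" "p1 - p2"] by simp
    ultimately show ?thesis
      by (simp add: dist_to_set_def)
  qed
  \<comment> \<open>The estimate holds for every minimizer at \<open>p2\<close>, so the whole space
    can serve as the neighbourhood of \<open>x\<close>.\<close>
  then show ?thesis
    unfolding aubin_constant_def using \<kappa>(1) r(1)
    by (intro conjI exI[of _ UNIV] exI[of _ "ball (c, b) r"]) auto
qed

theorem theorem3:
  fixes N :: "real^'n \<Rightarrow> real"
    and Q :: "real^'n^'n"
    and a :: "'m::finite \<Rightarrow> real^'n"
    and c xbar :: "real^'n"
    and b :: "real^'m"
  assumes "is_norm N"
    and "transpose Q = Q"
    and "pos_semidef Q"
    and "slater a b"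
    and "qp_argmin Q a (c, b) = {xbar}"
  shows "(aubin_property N (qp_argmin Q a) (c, b) xbar \<longleftrightarrow>
           (\<forall>D\<in>minimal_kkt_sets Q a c b xbar. nonsingular_on (UNIV <+> D) (kkt_matrix Q a))) \<and>
         (aubin_property N (qp_argmin Q a) (c, b) xbar \<longleftrightarrow>
           (\<forall>D\<in>independent_kkt_sets Q a c b xbar. nonsingular_on (UNIV <+> D) (kkt_matrix Q a))) \<and>
         (aubin_property N (qp_argmin Q a) (c, b) xbar \<longrightarrow>
           lip_modulus N (qp_argmin Q a) (c, b) xbar =
             ereal (Max (kkt_inverse_norm N Q a ` independent_kkt_sets Q a c b xbar)))"
proof -
  let ?S = "qp_argmin Q a"
  let ?L = "independent_kkt_sets Q a c b xbar"
  let ?M = "minimal_kkt_sets Q a c b xbar"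
  let ?ns = "\<lambda>D. nonsingular_on (UNIV <+> D) (kkt_matrix Q a)"
  define \<kappa> where "\<kappa> = Max (kkt_inverse_norm N Q a ` ?L)"
  have xbar: "xbar \<in> ?S (c, b)"
    using assms(5) by simp
  then have feas: "xbar \<in> feasible a b"
    by (simp add: qp_argmin_iff)
  \<comment> \<open>A member of the family makes \<open>Max\<close> range over a nonempty set and
    shows that it is nonnegative.\<close>
  obtain D0 where "D0 \<in> ?M"
    using argmin_minimal_kkt_set[OF assms(2) xbar] .
  then have "D0 \<in> ?L"
    using minimal_kkt_sets_subset by blast
  have upper: "kkt_inverse_norm N Q a D \<le> \<kappa>" if "D \<in> ?L" for D
    using that unfolding \<kappa>_def by (intro Max_ge) auto
  have "0 \<le> \<kappa>"
    using upper[OF \<open>D0 \<in> ?L\<close>] kkt_inverse_norm_nonneg[OF assms(1), of Q a D0] by linarith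
  have const: "aubin_constant N ?S (c, b) xbar \<kappa>" if "\<forall>D\<in>?L. ?ns D"
    using kkt_inverse_norm_aubin_constant[OF assms that \<open>0 \<le> \<kappa>\<close> upper] .
  have i_iii: "aubin_property N ?S (c, b) xbar \<longleftrightarrow> (\<forall>D\<in>?L. ?ns D)"
    using const xbar aubin_imp_nonsingular[OF assms(1-3) feas] unfolding aubin_property_def by blast
  have ii_iii: "(\<forall>D\<in>?M. ?ns D) \<longleftrightarrow> (\<forall>D\<in>?L. ?ns D)"
    using nonsingular_minimal_imp_independent[OF assms(2,3)] minimal_kkt_sets_subset by blast
  have "lip_modulus N ?S (c, b) xbar = ereal \<kappa>" if "\<forall>D\<in>?L. ?ns D"
    unfolding lip_modulus_def
  proof (rule antisym)
    show "(INF \<kappa>\<in>{\<kappa>. aubin_constant N ?S (c, b) xbar \<kappa>}. ereal \<kappa>) \<le> ereal \<kappa>"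
      using const[OF that] by (intro INF_lower) simp
    show "ereal \<kappa> \<le> (INF \<kappa>\<in>{\<kappa>. aubin_constant N ?S (c, b) xbar \<kappa>}. ereal \<kappa>)"
    proof (rule INF_greatest)
      fix k assume "k \<in> {\<kappa>. aubin_constant N ?S (c, b) xbar \<kappa>}"
      then have "\<kappa> \<le> k"
        unfolding \<kappa>_def using \<open>D0 \<in> ?L\<close> that
        by (intro Max.boundedI) (auto intro: aubin_constant_ge_kkt_inverse_norm[OF assms(1-3) feas])
      then show "ereal \<kappa> \<le> ereal k" by simp
    qed
  qed
  then show ?thesis
    using i_iii ii_iii unfolding \<kappa>_def by blast
qed

end
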